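(* Let $U$ be a utility function and let $p\in[1/2,1)$, with the Black–Scholes–Merton value function $u$ and the $n$-th binomial value functions $u_n$ as defined in the context. Then $$u(x)=\lim_{n\to\infty}u_n(x)\qquad\text{for every }x>0.$$
   Context: A utility function is a function $U:(0,\infty)\to\mathbb R$ that is strictly increasing, strictly concave, smooth ($C^\infty$), and satisfies the Inada conditions $\lim_{x\to0}U'(x)=\infty$ and $\lim_{x\to\infty}U'(x)=0$. Black–Scholes–Merton (BSM) model: $(\omega(t))_{0\le t\le1}$ is a standard Brownian motion on a probability space with measure $\mathcal P$ and the filtration generated by $\omega$; the price process is $S(t)=\exp(\omega(t))$. $\mathcal P^*$ is the unique probability measure equivalent to $\mathcal P$ under which $S$ is a martingale; its density is $Z=\frac{d\mathcal P^*}{d\mathcal P}=\exp(-\omega(1)/2-1/8)$. The value function is $u(x)=\sup\{\mathbb E_{\mathcal P}[U(X)]: X\ge0 \text{ measurable w.r.t. } \sigma(\omega(t),t\le1),\ \mathbb E_{\mathcal P^*}[X]\le x\}$. Binomial models: for $p\in(0,1)$ let $\alpha_1,\alpha_2,\dots$ be i.i.d. with $P[\alpha_j=1]=p$, $P[\alpha_j=0]=1-p$; set $\zeta_j=(\alpha_j-p)/\sqrt{p(1-p)}$ (so $E\zeta_j=0$, $\operatorname{Var}\zeta_j=1$) and $\xi_{n,k}=n^{-1/2}\sum_{j=1}^k\zeta_j$. The $n$-th model has price process $S^{(n)}(k/n)=e^{\xi_{n,k}}$, $k=0,\dots,n$, on the probability space generated by $\alpha_1,\dots,\alpha_n$ with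 measure $\mathcal P_n$; $\mathcal P_n^*$ is the unique probability measure equivalent to $\mathcal P_n$ under which $(S^{(n)}(k/n))_{k=0}^n$ is a martingale with respect to the filtration generated by the $\alpha_j$. The value function is $u_n(x)=\sup\{\mathbb E_{\mathcal P_n}[U(X_n)]: X_n\ge0\ \sigma(\alpha_1,\dots,\alpha_n)\text{-measurable},\ \mathbb E_{\mathcal P_n^*}[X_n]\le x\}$. *)

theory Defs
  imports "HOL-Probability.Probability"
begin

definition strictly_concave_on :: "real set \<Rightarrow> (real \<Rightarrow> real) \<Rightarrow> bool" where
  "strictly_concave_on S f \<longleftrightarrow>
     (\<forall>x\<in>S. \<forall>y\<in>S. \<forall>t::real. x \<noteq> y \<and> 0 < t \<and> t < 1 \<longrightarrow>
        f (t * x + (1 - t) * y) > t * f x + (1 - t) * f y)"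

definition smooth_on :: "real set \<Rightarrow> (real \<Rightarrow> real) \<Rightarrow> bool" where
  "smooth_on S f \<longleftrightarrow>
     (\<exists>D :: nat \<Rightarrow> real \<Rightarrow> real. (\<forall>x\<in>S. D 0 x = f x) \<and>
        (\<forall>k. \<forall>x\<in>S. (D k has_real_derivative D (Suc k) x) (at x)))"

definition utility_function :: "(real \<Rightarrow> real) \<Rightarrow> bool" where
  "utility_function U \<longleftrightarrow>
     strict_mono_on {0<..} U \<and>
     strictly_concave_on {0<..} U \<and>
     smooth_on {0<..} U \<and>
     filterlim (deriv U) at_top (at_right 0) \<and>
     (deriv U \<longlongrightarrow> 0) at_top"

text \<open>Extension of U to [0,oo): U(0) := lim_{x->0+} U(x) = inf of U on (0,oo), in the
  extended reals (may be -oo).\<close>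
definition Uext :: "(real \<Rightarrow> real) \<Rightarrow> real \<Rightarrow> ereal" where
  "Uext U x = (if 0 < x then ereal (U x) else (INF y\<in>{0::real<..}. ereal (U y)))"

definition exp_utility :: "'a measure \<Rightarrow> (real \<Rightarrow> real) \<Rightarrow> ('a \<Rightarrow> real) \<Rightarrow> ereal" where
  "exp_utility M U X =
     (let pos = (\<integral>\<^sup>+ \<omega>. e2ennreal (max 0 (Uext U (X \<omega>))) \<partial>M);
          neg = (\<integral>\<^sup>+ \<omega>. e2ennreal (max 0 (- Uext U (X \<omega>))) \<partial>M)
      in if neg = \<infinity> then -\<infinity> else enn2ereal pos - enn2ereal neg)"

definition std_brownian_motion_01 :: "'a measure \<Rightarrow> (real \<Rightarrow> 'a \<Rightarrow> real) \<Rightarrow> bool" where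
  "std_brownian_motion_01 M w \<longleftrightarrow>
     prob_space M \<and>
     (\<forall>t\<in>{0..1}. w t \<in> borel_measurable M) \<and>
     (\<forall>\<omega>\<in>space M. w 0 \<omega> = 0) \<and>
     (\<forall>\<omega>\<in>space M. continuous_on {0..1} (\<lambda>t. w t \<omega>)) \<and>
     (\<forall>s t. 0 \<le> s \<and> s < t \<and> t \<le> 1 \<longrightarrow>
        distributed M lborel (\<lambda>\<omega>. w t \<omega> - w s \<omega>) (\<lambda>x. ennreal (normal_density 0 (sqrt (t - s)) x))) \<and>
     (\<forall>(k::nat) (\<tau>::nat \<Rightarrow> real). \<tau> 0 \<ge> 0 \<and> \<tau> k \<le> 1 \<and> (\<forall>i<k. \<tau> i < \<tau> (Suc i)) \<longrightarrow>
        prob_space.indep_vars M (\<lambda>_. borel) (\<lambda>i \<omega>. w (\<tau> (Suc i)) \<omega> - w (\<tau> i) \<omega>) {..<k})"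

definition BM_sigma :: "'a measure \<Rightarrow> (real \<Rightarrow> 'a \<Rightarrow> real) \<Rightarrow> 'a measure" where
  "BM_sigma M w = sigma (space M) (\<Union>t\<in>{0..1}. {w t -` A \<inter> space M | A. A \<in> sets borel})"

text \<open>Density Z = dP*/dP = exp(-w(1)/2 - 1/8).\<close>
definition BSM_density :: "(real \<Rightarrow> 'a \<Rightarrow> real) \<Rightarrow> 'a \<Rightarrow> real" where
  "BSM_density w \<omega> = exp (- w 1 \<omega> / 2 - 1 / 8)"

definition BSM_value :: "'a measure \<Rightarrow> (real \<Rightarrow> 'a \<Rightarrow> real) \<Rightarrow> (real \<Rightarrow> real) \<Rightarrow> real \<Rightarrow> ereal" where
  "BSM_value M w U x =
     (SUP X\<in>{X. X \<in> borel_measurable (BM_sigma M w) \<and> (\<forall>\<omega>\<in>space M. 0 \<le> X \<omega>) \<and>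
              (\<integral>\<^sup>+ \<omega>. ennreal (BSM_density w \<omega> * X \<omega>) \<partial>M) \<le> ennreal x}.
        exp_utility M U X)"

text \<open>Sample space of the n-th model: \<omega> j = (alpha_{j+1} = 1) for j < n; the law P_n makes
  alpha_1..alpha_n i.i.d. Bernoulli(p) (coordinates j >= n are constantly False).\<close>
definition binom_P :: "real \<Rightarrow> nat \<Rightarrow> (nat \<Rightarrow> bool) pmf" where
  "binom_P p n = Pi_pmf {..<n} False (\<lambda>_. bernoulli_pmf p)"

definition binom_zeta :: "real \<Rightarrow> bool \<Rightarrow> real" where
  "binom_zeta p b = ((if b then 1 else 0) - p) / sqrt (p * (1 - p))"

definition binom_xi :: "real \<Rightarrow> nat \<Rightarrow> nat \<Rightarrow> (nat \<Rightarrow> bool) \<Rightarrow> real" where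
  "binom_xi p n k \<omega> = (\<Sum>j<k. binom_zeta p (\<omega> j)) / sqrt (real n)"

definition binom_S :: "real \<Rightarrow> nat \<Rightarrow> nat \<Rightarrow> (nat \<Rightarrow> bool) \<Rightarrow> real" where
  "binom_S p n k \<omega> = exp (binom_xi p n k \<omega>)"

text \<open>Events of the filtration generated by alpha_1..alpha_k.\<close>
definition binom_F_event :: "nat \<Rightarrow> (nat \<Rightarrow> bool) set \<Rightarrow> bool" where
  "binom_F_event k A \<longleftrightarrow> (\<forall>\<omega> \<omega>'. (\<forall>j<k. \<omega> j = \<omega>' j) \<longrightarrow> (\<omega> \<in> A \<longleftrightarrow> \<omega>' \<in> A))"

definition binom_EMM :: "real \<Rightarrow> nat \<Rightarrow> (nat \<Rightarrow> bool) pmf \<Rightarrow> bool" where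
  "binom_EMM p n Q \<longleftrightarrow>
     (\<forall>A. measure_pmf.prob Q A = 0 \<longleftrightarrow> measure_pmf.prob (binom_P p n) A = 0) \<and>
     (\<forall>k<n. \<forall>A. binom_F_event k A \<longrightarrow>
        measure_pmf.expectation Q (\<lambda>\<omega>. indicator A \<omega> * binom_S p n (Suc k) \<omega>) =
        measure_pmf.expectation Q (\<lambda>\<omega>. indicator A \<omega> * binom_S p n k \<omega>))"

definition binom_Pstar :: "real \<Rightarrow> nat \<Rightarrow> (nat \<Rightarrow> bool) pmf" where
  "binom_Pstar p n = (THE Q. binom_EMM p n Q)"

text \<open>X_n is sigma(alpha_1..alpha_n)-measurable: it depends only on the first n coordinates.\<close>
definition binom_value :: "real \<Rightarrow> nat \<Rightarrow> (real \<Rightarrow> real) \<Rightarrow> real \<Rightarrow> ereal" where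
  "binom_value p n U x =
     (SUP X\<in>{X. (\<forall>\<omega> \<omega>'. (\<forall>j<n. \<omega> j = \<omega>' j) \<longrightarrow> X \<omega> = X \<omega>') \<and> (\<forall>\<omega>. 0 \<le> X \<omega>) \<and>
              measure_pmf.expectation (binom_Pstar p n) X \<le> x}.
        exp_utility (measure_pmf (binom_P p n)) U X)"

end

theory Submission
  imports Defs "HOL-Real_Asymp.Real_Asymp"
begin

text \<open>
  Let \<open>V\<close> be the convex conjugate of \<open>U\<close>, let \<open>Z\<close>, \<open>Z\<^sub>n\<close> be the densities of the martingale
  measures, and put \<open>W(x) = inf {E V(yZ) + xy}\<close> over \<open>y > 0\<close>. Weak duality gives \<open>u \<le> W\<close> and
  \<open>u\<^sub>n(x) \<le> E V(yZ\<^sub>n) + xy\<close>. Conversely \<open>W\<close> is approached by payoffs \<open>I(max (yZ) d)\<close> with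
  \<open>I\<close> the inverse of \<open>U'\<close>; these are bounded continuous functions of \<open>Z\<close>, so the central limit
  theorem and Fatou's lemma (with \<open>E Z\<^sub>n = 1 = E Z\<close>) carry them over to the binomial models.

  What remains is \<open>limsup E V(yZ\<^sub>n) \<le> E V(yZ)\<close>, where the danger is the growth of \<open>V\<close> at \<open>0\<close>.
  One has \<open>Z\<^sub>n = exp (- a\<^sub>n \<xi>\<^sub>n - b\<^sub>n)\<close> with \<open>a\<^sub>n \<rightarrow> 1/2\<close> and \<open>b\<^sub>n \<rightarrow> 1/8\<close>. For \<open>p \<ge> 1/2\<close> both
  \<open>a\<^sub>n \<le> 1/2\<close> and \<open>P(\<xi>\<^sub>n \<ge> s) \<le> exp (- s\<^sup>2/2)\<close> hold, whence \<open>P(Z\<^sub>n \<le> z) \<le> C P(Z < l z)\<close> for every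
  fixed \<open>l > 1\<close>. The loss of the factor \<open>l\<close> is harmless, as the infimum defining \<open>W\<close> is approached
  by some \<open>y'\<close> such that \<open>V(yZ)\<close> is already integrable for a smaller \<open>y\<close>.
\<close>

section \<open>Elementary inequalities\<close>

text \<open>Where \<open>p \<ge> 1/2\<close> acts: \<open>\<zeta>\<close> takes the values
  \<open>zu\<close> and \<open>- zd\<close> with \<open>zu \<le> zd\<close>. One-step likelihood
  ratios are quotients of terms like
  \<open>(exp x - 1) / x = exp (x/2) * sinh (x/2) / (x/2)\<close>, so their logarithms are linear
  terms plus values of \<open>lsinhc\<close>. The linear terms give exactly 1/2 in
  \<open>a\<^sub>n\<close>; the correction is nonpositive because \<open>lsinhc\<close> increases
  and the up-step is the smaller one. The same skewness makes the upper tail of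
  \<open>\<xi>\<^sub>n\<close> obey a Chernoff bound with the true variance
  \<open>p * (1 - p)\<close>, hence with the exact Gaussian exponent. Why a factor
  \<open>l > 1\<close> is lost: a Chernoff bound misses the factor of order \<open>1/s\<close> of
  the normal tail, and \<open>b\<^sub>n\<close> merely converges to 1/8. A fixed shift of
  \<open>s\<close> repairs both. Why near-optimal payoffs must cost strictly less than
  \<open>x\<close>: the limit theorem transports strict inequalities only, and a payoff costing
  exactly \<open>x\<close> in the limit could violate the budget for every \<open>n\<close>. No
  minimax theorem is invoked: the dual side is reached by compactness of the multipliers, in a form
  that also covers an infinite dual value.\<close>

definition lsinhc :: "real \<Rightarrow> real" where
  "lsinhc x = ln (sinh x / x)"

text \<open>This is \<open>tanh (t/2) \<le> t/2\<close> cleared of denominators. It drives both the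
  Bernoulli moment bound and the monotonicity of \<open>lsinhc\<close>.\<close>

lemma two_exp_minus_one_le:
  fixes t :: real
  assumes "0 \<le> t"
  shows "2 * (exp t - 1) \<le> t * (exp t + 1)"
proof -
  have 1: "1 + (t - 1) * exp t \<ge> 0" if "0 \<le> t" for t :: real
  proof -
    have "(\<lambda>t::real. 1 + (t - 1) * exp t) 0 \<le> (\<lambda>t. 1 + (t - 1) * exp t) t"
      by (rule DERIV_nonneg_imp_nondecreasing[OF that])
         (auto intro!: exI derivative_eq_intros simp: algebra_simps)
    then show ?thesis by simp
  qed
  have "(\<lambda>t::real. t * (exp t + 1) - 2 * (exp t - 1)) 0 \<le> (\<lambda>t. t * (exp t + 1) - 2 * (exp t - 1)) t"
    by (rule DERIV_nonneg_imp_nondecreasing[OF assms])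
       (use 1 in \<open>auto intro!: exI derivative_eq_intros simp: algebra_simps\<close>)
  then show ?thesis by simp
qed

text \<open>Hoeffding's lemma would give the constant 1/4 in place of the variance
  \<open>p * (1 - p)\<close>, and so a wrong Gaussian exponent. The sharp constant is possible on
  one side only: the third cumulant \<open>p * (1 - p) * (1 - 2 * p)\<close> is nonpositive for
  \<open>p \<ge> 1/2\<close>. The proof compares logarithmic derivatives.\<close>

lemma bernoulli_mgf_le:
  fixes p t :: real
  assumes p: "1/2 \<le> p" "p < 1" and t: "0 \<le> t"
  shows "p * exp ((1 - p) * t) + (1 - p) * exp (- p * t) \<le> exp (p * (1 - p) * t\<^sup>2 / 2)"
proof -
  let ?m = "\<lambda>t. p * exp ((1 - p) * t) + (1 - p) * exp (- p * t)"
  let ?f = "\<lambda>t. p * (1 - p) * t\<^sup>2 / 2 - ln (?m t)"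
  have m_pos: "?m t > 0" for t
    using p by (intro add_pos_pos mult_pos_pos) auto
  have "?f 0 \<le> ?f t"
  proof (rule DERIV_nonneg_imp_nondecreasing[OF t])
    fix t :: real assume t: "0 \<le> t"
    let ?d = "p * (1 - p) * t - (p * (1 - p) * (exp ((1 - p) * t) - exp (- p * t))) / ?m t"
    have "(?f has_real_derivative ?d) (at t)"
      using m_pos[of t] by (auto intro!: derivative_eq_intros simp: field_simps)
    moreover have "exp ((1 - p) * t) - exp (- p * t) \<le> t * ?m t"
    proof -
      have "exp t - 1 \<le> t * ((exp t + 1) / 2)"
        using two_exp_minus_one_le[OF t] by simp
      \<comment> \<open>Here \<open>p \<ge> 1/2\<close> enters: more weight on
        \<open>exp t \<ge> 1\<close> can only increase the average.\<close>
      also have "\<dots> \<le> t * (p * exp t + (1 - p))"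
      proof (rule mult_left_mono[OF _ t])
        have "(p - 1/2) * (exp t - 1) \<ge> 0" using p t by simp
        then show "(exp t + 1) / 2 \<le> p * exp t + (1 - p)" by (simp add: field_simps)
      qed
      finally have "exp (- p * t) * (exp t - 1) \<le> exp (- p * t) * (t * (p * exp t + (1 - p)))"
        by (rule mult_left_mono) simp
      moreover have "exp ((1 - p) * t) = exp (- p * t) * exp t"
        by (simp add: mult_exp_exp algebra_simps)
      ultimately show ?thesis by (simp add: algebra_simps)
    qed
    then have "p * (1 - p) * (exp ((1 - p) * t) - exp (- p * t)) \<le> p * (1 - p) * (t * ?m t)"
      using p by (intro mult_left_mono) auto
    then have "?d \<ge> 0" using m_pos[of t] by (simp add: divide_le_eq mult_ac)
    ultimately show "\<exists>d. (?f has_real_derivative d) (at t) \<and> 0 \<le> d" by blast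
  qed
  then have "ln (?m t) \<le> p * (1 - p) * t\<^sup>2 / 2" by simp
  then have "exp (ln (?m t)) \<le> exp (p * (1 - p) * t\<^sup>2 / 2)" by simp
  then show ?thesis by (simp only: exp_ln[OF m_pos])
qed

text \<open>The derivative of \<open>sinh x / x\<close> has the sign of
  \<open>x * cosh x - sinh x\<close>, and \<open>tanh x \<le> x\<close>. This monotonicity is what
  later bounds \<open>an n\<close> by 1/2.\<close>

lemma lsinhc_mono:
  assumes "0 < x" "x \<le> y"
  shows "lsinhc x \<le> lsinhc y"
proof -
  have c: "sinh x \<le> x * cosh x" if "0 < x" for x :: real
  proof -
    have "2 * (exp (2*x) - 1) \<le> 2 * x * (exp (2*x) + 1)"
      using two_exp_minus_one_le[of "2*x"] that by simp
    then have "exp (-x) * (2 * (exp (2*x) - 1)) \<le> exp (-x) * (2 * x * (exp (2*x) + 1))"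
      by (rule mult_left_mono) simp
    moreover have "exp (2*x) = exp x * exp x" by (simp add: mult_exp_exp)
    moreover have "exp (-x) * exp x = 1" by (simp add: mult_exp_exp)
    ultimately show ?thesis
      by (simp add: sinh_field_def cosh_field_def algebra_simps)
  qed
  have "sinh x / x \<le> sinh y / y"
  proof (rule DERIV_nonneg_imp_nondecreasing[OF assms(2)])
    fix t assume "x \<le> t"
    then have t: "t > 0" using assms by simp
    have "((\<lambda>a. sinh a / a) has_real_derivative (cosh t * t - sinh t) / (t * t)) (at t)"
      using t by (auto intro!: derivative_eq_intros)
    moreover have "(cosh t * t - sinh t) / (t * t) \<ge> 0"
      using c[OF t] t by (simp add: mult_ac)
    ultimately show "\<exists>d. ((\<lambda>a. sinh a / a) has_real_derivative d) (at t) \<and> 0 \<le> d" by blast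
  qed
  then show ?thesis
    unfolding lsinhc_def using assms by (subst ln_le_cancel_iff) auto
qed

lemma lsinhc_asymp: "((\<lambda>x. lsinhc x / x\<^sup>2) \<longlongrightarrow> 1/6) (at_right 0)"
  unfolding lsinhc_def by real_asymp

text \<open>Since \<open>sinh x / x = 1 + x\<^sup>2 / 6 + ...\<close>, a step of size
  \<open>c / sqrt n\<close> contributes order \<open>1/n\<close>, and \<open>n\<close> steps leave a
  finite limit.\<close>

lemma lsinhc_scaled_limit:
  fixes c :: real
  assumes "0 < c"
  shows "(\<lambda>n. lsinhc (c / sqrt (real n)) * real n) \<longlonglongrightarrow> c\<^sup>2 / 6"
proof -
  have "filterlim (\<lambda>n. c / sqrt (real n)) (at_right 0) sequentially"
    using assms by real_asymp
  from filterlim_compose[OF lsinhc_asymp this]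
  have "(\<lambda>n. c\<^sup>2 * (lsinhc (c / sqrt (real n)) / (c / sqrt (real n))\<^sup>2)) \<longlonglongrightarrow> c\<^sup>2 * (1/6)"
    by (rule tendsto_mult_left)
  moreover have "c\<^sup>2 * (lsinhc (c / sqrt (real n)) / (c / sqrt (real n))\<^sup>2) = lsinhc (c / sqrt (real n)) * real n" for n
    using assms by (cases "n = 0") (auto simp: power_divide)
  ultimately show ?thesis by simp
qed

text \<open>Factoring out \<open>exp (x/2)\<close> turns the difference into
  \<open>2 * sinh (x/2)\<close>: the odd part of the logarithm is linear, the even part is
  \<open>lsinhc\<close>.\<close>

lemma ln_exp_minus_one_div: "0 < x \<Longrightarrow> ln ((exp x - 1) / x) = x / 2 + lsinhc (x / 2)"
proof -
  assume x: "0 < x"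
  have "(exp x - 1) / x = exp (x/2) * (sinh (x/2) / (x/2))"
    using x by (simp add: sinh_field_def field_simps mult_exp_exp)
  also have "ln \<dots> = x / 2 + lsinhc (x / 2)"
    unfolding lsinhc_def using x by (subst ln_mult) auto
  finally show ?thesis .
qed

lemma ln_one_minus_exp_div: "0 < x \<Longrightarrow> ln ((1 - exp (- x)) / x) = - x / 2 + lsinhc (x / 2)"
proof -
  assume x: "0 < x"
  have "(1 - exp (-x)) / x = exp (-x/2) * (sinh (x/2) / (x/2))"
    using x by (simp add: sinh_field_def field_simps mult_exp_exp)
  also have "ln \<dots> = - x / 2 + lsinhc (x / 2)"
    unfolding lsinhc_def using x by (subst ln_mult) auto
  finally show ?thesis .
qed

lemma ln_exp_diff_div:
  assumes "0 < u" "0 < v"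
  shows "ln ((exp u - exp (- v)) / (u + v)) = (u - v) / 2 + lsinhc ((u + v) / 2)"
proof -
  have "(exp u - exp (- v)) / (u + v) = exp (-v) * ((exp (u + v) - 1) / (u + v))"
    using assms by (simp add: field_simps mult_exp_exp)
  also have "ln \<dots> = - v + ((u + v) / 2 + lsinhc ((u + v) / 2))"
    using assms by (subst ln_mult) (auto simp: ln_exp_minus_one_div divide_pos_pos)
  finally show ?thesis by (simp add: field_simps)
qed

section \<open>Utility functions and their conjugates\<close>

text \<open>The functions composed with densities (\<open>I\<close>, \<open>V\<close>) are
  controlled on the positive half-line only, so measurability is proved for the version set to 0
  elsewhere and then transferred.\<close>

lemma measurable_comp_pos:
  fixes g :: "real \<Rightarrow> real"
  assumes "continuous_on {0<..} g" and [measurable]: "Z \<in> borel_measurable M"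
    and "\<And>\<omega>. \<omega> \<in> space M \<Longrightarrow> 0 < Z \<omega>"
  shows "(\<lambda>\<omega>. g (Z \<omega>)) \<in> borel_measurable M"
proof -
  have [measurable]: "(\<lambda>x. if x \<in> {0<..} then g x else 0) \<in> borel_measurable borel"
    using assms(1) by (intro borel_measurable_continuous_on_if) auto
  have "(\<lambda>\<omega>. (\<lambda>x. if x \<in> {0<..} then g x else 0) (Z \<omega>)) \<in> borel_measurable M"
    by measurable
  then show ?thesis
    by (rule measurable_cong[THEN iffD1, rotated]) (use assms(3) in auto)
qed

locale utility =
  fixes U :: "real \<Rightarrow> real"
  assumes utility: "utility_function U"
begin

lemma U_strict_mono: "0 < x \<Longrightarrow> x < y \<Longrightarrow> U x < U y"
  using utility unfolding utility_function_def strict_mono_on_def by auto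

lemma U_mono: "0 < x \<Longrightarrow> x \<le> y \<Longrightarrow> U x \<le> U y"
  using U_strict_mono[of x y] by (cases "x = y") auto

lemma U_has_derivative: "0 < x \<Longrightarrow> (U has_real_derivative deriv U x) (at x)"
  and deriv_U_continuous: "continuous_on {0<..} (deriv U)"
proof -
  obtain D :: "nat \<Rightarrow> real \<Rightarrow> real" where D0: "\<And>x. 0 < x \<Longrightarrow> D 0 x = U x"
    and D: "\<And>k x. 0 < x \<Longrightarrow> (D k has_real_derivative D (Suc k) x) (at x)"
    using utility unfolding utility_function_def smooth_on_def by auto
  have d: "(U has_real_derivative D 1 x) (at x)" if x: "0 < x" for x
  proof (rule has_field_derivative_transform_within_open[where S="{0<..}"])
    show "(D 0 has_real_derivative D 1 x) (at x)" using D[OF x, of 0] by simp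
  qed (use x D0 in auto)
  have e: "deriv U x = D 1 x" if "0 < x" for x
    by (rule DERIV_imp_deriv[OF d[OF that]])
  show "0 < x \<Longrightarrow> (U has_real_derivative deriv U x) (at x)"
    using d[of x] e[of x] by simp
  have "continuous_on {0<..} (D 1)"
    by (rule DERIV_continuous_on[OF has_field_derivative_at_within, OF D]) auto
  then show "continuous_on {0<..} (deriv U)"
    by (rule continuous_on_eq) (simp add: e)
qed

lemma U_continuous: "continuous_on {0<..} U"
  by (rule DERIV_continuous_on[OF has_field_derivative_at_within, OF U_has_derivative]) auto

lemma U_strictly_concave:
  "\<lbrakk>0 < x; 0 < y; x \<noteq> y; 0 < t; t < 1\<rbrakk> \<Longrightarrow> t * U x + (1 - t) * U y < U (t * x + (1 - t) * y)"
  using utility unfolding utility_function_def strictly_concave_on_def by simp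

lemma U_tangent:
  assumes "0 < a" "0 < b"
  shows "U b \<le> U a + deriv U a * (b - a)"
proof -
  have "convex_on {0<..} (\<lambda>x. - U x)"
  proof (rule convex_onI)
    fix t x y :: real assume t: "0 < t" "t < 1" and xy: "x \<in> {0<..}" "y \<in> {0<..}"
    show "- U ((1 - t) *\<^sub>R x + t *\<^sub>R y) \<le> (1 - t) * - U x + t * - U y"
    proof (cases "x = y")
      case True then show ?thesis by (simp add: algebra_simps)
    next
      case False
      then show ?thesis using U_strictly_concave[of x y "1 - t"] t xy by simp
    qed
  qed simp
  moreover have "((\<lambda>x. - U x) has_field_derivative - deriv U a) (at a within {0<..})"
    by (rule has_field_derivative_at_within[OF DERIV_minus[OF U_has_derivative[OF assms(1)]]])
  ultimately have "- U b - - U a \<ge> - deriv U a * (b - a)"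
    using assms by (intro convex_on_imp_above_tangent[where A="{0<..}"])
      (auto simp: interior_open)
  then show ?thesis by simp
qed

text \<open>Strict concavity at the midpoint of \<open>a\<close> and \<open>b\<close>, followed by
  the non-strict tangent bound at that midpoint.\<close>

lemma U_tangent_strict:
  assumes "0 < a" "0 < b" "a \<noteq> b"
  shows "U b < U a + deriv U a * (b - a)"
proof -
  let ?m = "(a + b) / 2"
  have "U a / 2 + U b / 2 = 1/2 * U a + (1 - 1/2) * U b" by simp
  also have "\<dots> < U (1/2 * a + (1 - 1/2) * b)"
    using assms by (intro U_strictly_concave) auto
  also have "1/2 * a + (1 - 1/2) * b = ?m" by simp
  also have "U ?m \<le> U a + deriv U a * (?m - a)"
    using assms by (intro U_tangent) auto
  also have "?m - a = (b - a) / 2" by (simp add: field_simps)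
  also have "deriv U a * ((b - a) / 2) = deriv U a * (b - a) / 2" by simp
  finally show ?thesis by linarith
qed

text \<open>Adding the strict tangent bounds at \<open>a\<close> and at \<open>b\<close> cancels the
  values of \<open>U\<close>.\<close>

lemma deriv_U_strict_antimono:
  assumes "0 < a" "a < b"
  shows "deriv U b < deriv U a"
proof -
  have "U b < U a + deriv U a * (b - a)"
    using assms by (intro U_tangent_strict) auto
  moreover have "U a < U b + deriv U b * (a - b)"
    using assms by (intro U_tangent_strict) auto
  ultimately have "0 < (deriv U a - deriv U b) * (b - a)" by (simp add: algebra_simps)
  then have "0 < deriv U a - deriv U b"
    by (rule zero_less_mult_pos2) (use assms in simp)
  then show ?thesis by simp
qed

lemma deriv_U_pos:
  assumes "0 < x"
  shows "0 < deriv U x"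
proof -
  have "U x < U (x + 1)" using assms by (intro U_strict_mono) auto
  also have "\<dots> \<le> U x + deriv U x * (x + 1 - x)" using assms by (intro U_tangent) auto
  finally show ?thesis by simp
qed

text \<open>For \<open>z > 0\<close> a solution exists by the Inada conditions and the intermediate
  value theorem, and is unique by strict monotonicity of \<open>deriv U\<close>; nothing is claimed
  for \<open>z \<le> 0\<close>, which is why arguments of \<open>I\<close> are always kept
  positive.\<close>

definition I :: "real \<Rightarrow> real" where
  "I z = (THE x. 0 < x \<and> deriv U x = z)"

lemma deriv_U_inj: "0 < a \<Longrightarrow> 0 < b \<Longrightarrow> deriv U a = deriv U b \<Longrightarrow> a = b"
  by (metis deriv_U_strict_antimono less_irrefl linorder_neqE_linordered_idom)

lemma I_deriv_U: "0 < x \<Longrightarrow> I (deriv U x) = x"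
  unfolding I_def by (rule the_equality) (auto intro: deriv_U_inj)

lemma ex_deriv_U_eq:
  assumes "0 < z"
  shows "\<exists>x>0. deriv U x = z"
proof -
  have "filterlim (deriv U) at_top (at_right 0)" "(deriv U \<longlongrightarrow> 0) at_top"
    using utility unfolding utility_function_def by auto
  then have "eventually (\<lambda>x. z \<le> deriv U x) (at_right 0)" "eventually (\<lambda>x. deriv U x < z) at_top"
    using assms by (auto simp: filterlim_at_top order_tendsto_iff)
  then have "eventually (\<lambda>x. z \<le> deriv U x \<and> 0 < x) (at_right 0)"
    "eventually (\<lambda>x. deriv U x < z \<and> 0 < x) at_top"
    using eventually_at_right_less[of "0::real"] eventually_gt_at_top[of "0::real"]
    by (auto intro: eventually_conj)
  then obtain a b where ab: "z \<le> deriv U a" "0 < a" "deriv U b < z" "0 < b"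
    by (auto dest!: eventually_happens)
  have le: "a \<le> b"
    using ab deriv_U_strict_antimono[of b a] by (cases "a \<le> b") auto
  have "\<exists>x\<ge>a. x \<le> b \<and> deriv U x = z"
    using ab le by (intro IVT2' continuous_on_subset[OF deriv_U_continuous]) auto
  then obtain x where "a \<le> x" "deriv U x = z" by blast
  then show ?thesis using ab by (intro exI[of _ x]) auto
qed

lemma I_pos: "0 < z \<Longrightarrow> 0 < I z"
  and deriv_U_I: "0 < z \<Longrightarrow> deriv U (I z) = z"
proof -
  assume "0 < z"
  then obtain x where x: "0 < x" "deriv U x = z" using ex_deriv_U_eq by blast
  then have "I z = x" using I_deriv_U[of x] by simp
  then show "0 < I z" "deriv U (I z) = z" using x by simp_all
qed

lemma I_antimono:
  assumes "0 < z" "z \<le> w"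
  shows "I w \<le> I z"
proof (rule ccontr)
  assume "\<not> I w \<le> I z"
  then have "deriv U (I w) < deriv U (I z)"
    using I_pos[OF assms(1)] by (intro deriv_U_strict_antimono) auto
  then show False using assms by (simp add: deriv_U_I)
qed

lemma isCont_I:
  assumes z: "0 < z"
  shows "isCont I z"
proof -
  let ?x = "I z"
  have x: "0 < ?x" using z by (rule I_pos)
  have "isCont I (deriv U ?x)"
  proof (rule isCont_inverse_function2[where f="deriv U" and g=I and x="?x" and a="?x / 2" and b="?x + 1"])
    show "\<And>y. \<lbrakk>?x / 2 \<le> y; y \<le> ?x + 1\<rbrakk> \<Longrightarrow> I (deriv U y) = y"
      using x by (intro I_deriv_U) simp
    show "\<And>y. \<lbrakk>?x / 2 \<le> y; y \<le> ?x + 1\<rbrakk> \<Longrightarrow> isCont (deriv U) y"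
      using x deriv_U_continuous by (subst (asm) continuous_on_eq_continuous_at) auto
  qed (use x in auto)
  then show "isCont I z" using deriv_U_I[OF z] by simp
qed

lemma I_continuous: "continuous_on {0<..} I"
  by (rule continuous_at_imp_continuous_on) (auto intro: isCont_I)

lemma I_tendsto_0: "(I \<longlongrightarrow> 0) at_top"
proof (rule order_tendstoI)
  fix e :: real assume "0 < e"
  show "eventually (\<lambda>z. I z < e) at_top"
    using eventually_gt_at_top[of "deriv U (e/2)"]
  proof eventually_elim
    case (elim z)
    then have "I z \<le> I (deriv U (e/2))"
      using deriv_U_pos[of "e/2"] \<open>0 < e\<close> by (intro I_antimono) auto
    then show ?case using \<open>0 < e\<close> by (simp add: I_deriv_U)
  qed
next
  fix e :: real assume "e < 0"
  show "eventually (\<lambda>z. e < I z) at_top"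
    using eventually_gt_at_top[of 0] by eventually_elim (use I_pos \<open>e < 0\<close> in force)
qed

text \<open>The supremum of \<open>U a - z * a\<close> over \<open>a > 0\<close>, written through
  its maximiser \<open>I z\<close>; that it is the maximum is the tangent inequality at
  \<open>I z\<close>, stated as \<open>fenchel\<close>.\<close>

definition V :: "real \<Rightarrow> real" where
  "V z = U (I z) - z * I z"

lemma fenchel: "0 < z \<Longrightarrow> 0 < a \<Longrightarrow> U a \<le> V z + z * a"
  using U_tangent[of "I z" a] by (simp add: V_def deriv_U_I I_pos algebra_simps)

lemma V_antimono: assumes "0 < z" "z \<le> w" shows "V w \<le> V z"
proof -
  have "V w \<le> U (I w) - z * I w"
    using assms I_pos[of w] unfolding V_def by (simp add: mult_right_mono)
  also have "\<dots> \<le> V z" using fenchel[of z "I w"] assms I_pos[of w] by simp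
  finally show ?thesis .
qed

lemma U_I_continuous: "continuous_on {0<..} (\<lambda>z. U (I z))"
  by (rule continuous_on_compose2[OF U_continuous I_continuous]) (use I_pos in auto)

lemma V_continuous: "continuous_on {0<..} V"
  unfolding V_def by (intro continuous_intros U_I_continuous I_continuous)

text \<open>At \<open>a = 0\<close>, where \<open>Uext\<close> may be minus infinity, the Fenchel
  inequality follows by letting \<open>a = r / z\<close> tend to 0.\<close>

lemma Uext_le:
  assumes "0 < z" "0 \<le> a"
  shows "Uext U a \<le> ereal (V z + z * a)"
proof (cases "0 < a")
  case True then show ?thesis using fenchel[OF assms(1)] by (simp add: Uext_def)
next
  case False
  have "Uext U 0 \<le> ereal (V z) + ereal r" if r: "0 < r" for r
  proof -
    have "Uext U 0 \<le> ereal (U (r / z))"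
      unfolding Uext_def using r assms by (auto intro!: INF_lower2[of "r / z"])
    also have "\<dots> \<le> ereal (V z + r)"
      using fenchel[of z "r / z"] assms r by simp
    finally show ?thesis by simp
  qed
  then have "Uext U 0 \<le> ereal (V z)"
    by (rule ereal_le_epsilon2)
  then show ?thesis using False assms by simp
qed

lemma Uext_measurable [measurable]: "Uext U \<in> borel_measurable borel"
proof -
  have [measurable]: "(\<lambda>x. if x \<in> {0<..} then U x else 0) \<in> borel_measurable borel"
    using U_continuous by (intro borel_measurable_continuous_on_if) auto
  have "(\<lambda>x. if 0 < x then ereal ((\<lambda>x. if x \<in> {0<..} then U x else 0) x)
      else (INF y\<in>{0::real<..}. ereal (U y))) \<in> borel_measurable borel"
    by measurable
  also have "(\<lambda>x. if 0 < x then ereal ((\<lambda>x. if x \<in> {0<..} then U x else 0) x)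
      else (INF y\<in>{0::real<..}. ereal (U y))) = Uext U"
    by (auto simp: Uext_def)
  finally show ?thesis .
qed

end

section \<open>Duality for a given density\<close>

lemma e2ennreal_max_0: "e2ennreal (max 0 (ereal s)) = ennreal s"
  by (cases "0 \<le> s") (auto simp: max_def e2ennreal_ereal ennreal_neg)

text \<open>One abstract setting for three spaces: the normal law with \<open>bs_density\<close>,
  the binomial measure with \<open>dens n\<close>, and the space of the Brownian motion with
  \<open>BSM_density\<close>.\<close>

locale utility_density = utility U + prob_space M
  for U :: "real \<Rightarrow> real" and M :: "'a measure" +
  fixes Z :: "'a \<Rightarrow> real"
  assumes Z_pos: "\<And>\<omega>. \<omega> \<in> space M \<Longrightarrow> 0 < Z \<omega>"
    and Z_integrable [simp]: "integrable M Z"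
    and Z_mean: "expectation Z = 1"
begin

lemma Z_measurable [measurable]: "Z \<in> borel_measurable M"
  using Z_integrable by (rule borel_measurable_integrable)

text \<open>Pointwise Fenchel with \<open>z = y * Z\<close> gives
  \<open>Uext U X \<le> V (y * Z) + y * Z * X\<close>; the mean of the last term is at most
  \<open>x * y\<close>.\<close>

lemma weak_duality:
  assumes y: "0 < y" and V_int: "integrable M (\<lambda>\<omega>. V (y * Z \<omega>))"
    and [measurable]: "X \<in> borel_measurable M" and X0: "\<And>\<omega>. \<omega> \<in> space M \<Longrightarrow> 0 \<le> X \<omega>"
    and ZX: "integrable M (\<lambda>\<omega>. Z \<omega> * X \<omega>)" "expectation (\<lambda>\<omega>. Z \<omega> * X \<omega>) \<le> x"
  shows "exp_utility M U X \<le> ereal (expectation (\<lambda>\<omega>. V (y * Z \<omega>)) + x * y)"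
proof -
  define F where "F \<omega> = V (y * Z \<omega>) + y * (Z \<omega> * X \<omega>)" for \<omega>
  have F_int: "integrable M F"
    unfolding F_def using V_int ZX(1) by auto
  then have F_meas [measurable]: "F \<in> borel_measurable M" by auto
  have "expectation F = expectation (\<lambda>\<omega>. V (y * Z \<omega>)) + y * expectation (\<lambda>\<omega>. Z \<omega> * X \<omega>)"
    unfolding F_def using V_int ZX(1) by simp
  also have "\<dots> \<le> expectation (\<lambda>\<omega>. V (y * Z \<omega>)) + y * x"
    using ZX(2) y by simp
  finally have F_le: "expectation F \<le> expectation (\<lambda>\<omega>. V (y * Z \<omega>)) + x * y"
    by (simp add: mult.commute)
  define P where "P = (\<integral>\<^sup>+ \<omega>. e2ennreal (max 0 (Uext U (X \<omega>))) \<partial>M)"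
  define N where "N = (\<integral>\<^sup>+ \<omega>. e2ennreal (max 0 (- Uext U (X \<omega>))) \<partial>M)"
  define Fp where "Fp = (\<integral>\<^sup>+ \<omega>. ennreal (F \<omega>) \<partial>M)"
  define Fm where "Fm = (\<integral>\<^sup>+ \<omega>. ennreal (- F \<omega>) \<partial>M)"
  have fin: "Fp \<noteq> \<infinity>" "Fm \<noteq> \<infinity>"
    using F_int unfolding Fp_def Fm_def real_integrable_def by auto
  have F_eq: "expectation F = enn2real Fp - enn2real Fm"
    using F_int unfolding Fp_def Fm_def by (rule real_lebesgue_integral_def)
  \<comment> \<open>The pointwise bound is integrated after moving negative parts to the other side:
    \<open>Uext\<close> may be minus infinity and \<open>P\<close> is not yet known to be finite, so
    no differences are formed.\<close>
  have "P + Fm \<le> Fp + N"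
  proof -
    have "P + Fm = (\<integral>\<^sup>+ \<omega>. e2ennreal (max 0 (Uext U (X \<omega>))) + ennreal (- F \<omega>) \<partial>M)"
      unfolding P_def Fm_def by (subst nn_integral_add) auto
    also have "\<dots> \<le> (\<integral>\<^sup>+ \<omega>. ennreal (F \<omega>) + e2ennreal (max 0 (- Uext U (X \<omega>))) \<partial>M)"
    proof (rule nn_integral_mono)
      fix \<omega> assume \<omega>: "\<omega> \<in> space M"
      have le: "Uext U (X \<omega>) \<le> ereal (F \<omega>)"
        using Uext_le[of "y * Z \<omega>" "X \<omega>"] y X0[OF \<omega>] Z_pos[OF \<omega>] by (simp add: F_def mult_ac)
      show "e2ennreal (max 0 (Uext U (X \<omega>))) + ennreal (- F \<omega>) \<le>
          ennreal (F \<omega>) + e2ennreal (max 0 (- Uext U (X \<omega>)))"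
      proof (cases "Uext U (X \<omega>)")
        case (real r)
        then have "r \<le> F \<omega>" using le by simp
        have "ennreal r + ennreal (- F \<omega>) \<le> ennreal (F \<omega>) + ennreal (- r)"
        proof -
          have "max 0 r + max 0 (- F \<omega>) \<le> max 0 (F \<omega>) + max 0 (- r)"
            using \<open>r \<le> F \<omega>\<close> by linarith
          then have "ennreal (max 0 r + max 0 (- F \<omega>)) \<le> ennreal (max 0 (F \<omega>) + max 0 (- r))"
            by (rule ennreal_leI)
          then show ?thesis by simp
        qed
        then show ?thesis using real by (simp add: e2ennreal_max_0)
      next
        case PInf then show ?thesis using le by simp
      next
        case MInf then show ?thesis by simp
      qed
    qed
    also have "\<dots> = Fp + N"
      unfolding Fp_def N_def by (subst nn_integral_add) auto
    finally show ?thesis .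
  qed
  show ?thesis
  proof (cases "N = \<infinity>")
    case True then show ?thesis by (simp add: exp_utility_def Let_def N_def)
  next
    case False
    obtain n where n: "N = ennreal n" "0 \<le> n" using False by (cases N) auto
    obtain a where a: "Fp = ennreal a" "0 \<le> a" using fin by (cases Fp) auto
    obtain b where b: "Fm = ennreal b" "0 \<le> b" using fin by (cases Fm) auto
    \<comment> \<open>With \<open>N\<close> finite, the comparison forces \<open>P\<close> to be
      finite as well, and the expected utility is a real difference.\<close>
    have "P + Fm \<noteq> \<infinity>" using \<open>P + Fm \<le> Fp + N\<close> n a by (auto simp: top_unique simp flip: ennreal_plus)
    then obtain q where q: "P = ennreal q" "0 \<le> q" by (cases P) auto
    have "ennreal (q + b) \<le> ennreal (a + n)"
      using \<open>P + Fm \<le> Fp + N\<close> n a b q by (simp add: ennreal_plus)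
    then have "q + b \<le> a + n" using n a by (subst (asm) ennreal_le_iff) auto
    then have "q - n \<le> expectation F" using F_eq a b by simp
    moreover have "exp_utility M U X = ereal (q - n)"
      unfolding exp_utility_def Let_def P_def[symmetric] N_def[symmetric] using q n False
      by (simp add: enn2ereal_ennreal)
    ultimately show ?thesis using F_le by simp
  qed
qed

lemma exp_utility_eq_expectation:
  assumes "\<And>\<omega>. \<omega> \<in> space M \<Longrightarrow> 0 < X \<omega>" "integrable M (\<lambda>\<omega>. U (X \<omega>))"
  shows "exp_utility M U X = ereal (expectation (\<lambda>\<omega>. U (X \<omega>)))"
proof -
  let ?p = "\<integral>\<^sup>+ \<omega>. ennreal (U (X \<omega>)) \<partial>M" and ?n = "\<integral>\<^sup>+ \<omega>. ennreal (- U (X \<omega>)) \<partial>M"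
  have p: "(\<integral>\<^sup>+ \<omega>. e2ennreal (max 0 (Uext U (X \<omega>))) \<partial>M) = ?p"
    using assms(1) by (intro nn_integral_cong) (simp add: Uext_def e2ennreal_max_0)
  have n: "(\<integral>\<^sup>+ \<omega>. e2ennreal (max 0 (- Uext U (X \<omega>))) \<partial>M) = ?n"
    using assms(1) by (intro nn_integral_cong) (simp add: Uext_def e2ennreal_max_0)
  have fin: "?p \<noteq> \<infinity>" "?n \<noteq> \<infinity>"
    using assms(2) unfolding real_integrable_def by auto
  then obtain a b where "?p = ennreal a" "?n = ennreal b" "0 \<le> a" "0 \<le> b"
    by (metis ennreal_cases infinity_ennreal_def)
  then show ?thesis
    unfolding exp_utility_def p n real_lebesgue_integral_def[OF assms(2)] by (simp add: enn2ereal_ennreal)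
qed

section \<open>Truncated candidate payoffs and the budget equation\<close>

definition J :: "real \<Rightarrow> real \<Rightarrow> 'a \<Rightarrow> real" where
  "J d y \<omega> = I (max (y * Z \<omega>) d)"

context
  fixes d :: real
  assumes d: "0 < d"
begin

lemma comp_max_measurable:
  assumes "continuous_on {0<..} (g :: real \<Rightarrow> real)"
  shows "(\<lambda>\<omega>. g (max (y * Z \<omega>) d)) \<in> borel_measurable M"
  using d by (intro measurable_comp_pos[OF assms]) (auto simp: less_max_iff_disj)

lemma J_pos: "0 < J d y \<omega>"
  unfolding J_def using d by (intro I_pos) (simp add: less_max_iff_disj)

lemma J_le: "J d y \<omega> \<le> I d"
  unfolding J_def using d by (intro I_antimono) auto

lemma J_measurable [measurable]: "J d y \<in> borel_measurable M"
  unfolding J_def[abs_def] by (rule comp_max_measurable[OF I_continuous])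

text \<open>The free parameter \<open>a\<close> is the slope of an affine minorant in
  \<open>Z\<close>. Slope 1 suffices for integrability; a small slope is needed later to bound the
  multipliers.\<close>

lemma V_max_bounds:
  assumes "0 \<le> y" "\<omega> \<in> space M" "0 < a"
  shows "V (max (y * Z \<omega>) d) \<le> V d" "U a - a * d - a * y * Z \<omega> \<le> V (max (y * Z \<omega>) d)"
proof -
  show "V (max (y * Z \<omega>) d) \<le> V d" using d by (intro V_antimono) auto
  have "U a \<le> V (max (y * Z \<omega>) d) + max (y * Z \<omega>) d * a"
    using d assms by (intro fenchel) auto
  also have "max (y * Z \<omega>) d * a \<le> (y * Z \<omega> + d) * a"
    using d assms Z_pos[of \<omega>] by (intro mult_right_mono) auto
  finally show "U a - a * d - a * y * Z \<omega> \<le> V (max (y * Z \<omega>) d)" by (simp add: algebra_simps)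
qed

lemma integrable_V_max: "0 \<le> y \<Longrightarrow> integrable M (\<lambda>\<omega>. V (max (y * Z \<omega>) d))"
proof -
  assume y: "0 \<le> y"
  show ?thesis
  proof (rule Bochner_Integration.integrable_bound)
    show "integrable M (\<lambda>\<omega>. \<bar>V d\<bar> + \<bar>U 1\<bar> + d + y * Z \<omega>)" by auto
    show "AE \<omega> in M. norm (V (max (y * Z \<omega>) d)) \<le> norm (\<bar>V d\<bar> + \<bar>U 1\<bar> + d + y * Z \<omega>)"
    proof (rule AE_I2)
      fix \<omega> assume \<omega>: "\<omega> \<in> space M"
      have "0 \<le> y * Z \<omega>" using y Z_pos[OF \<omega>] by simp
      then show "norm (V (max (y * Z \<omega>) d)) \<le> norm (\<bar>V d\<bar> + \<bar>U 1\<bar> + d + y * Z \<omega>)"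
        using V_max_bounds[OF y \<omega>, of 1] d by simp
    qed
  qed (rule comp_max_measurable[OF V_continuous])
qed

lemma integrable_Z_J: "integrable M (\<lambda>\<omega>. Z \<omega> * J d y \<omega>)"
proof (rule Bochner_Integration.integrable_bound)
  show "integrable M (\<lambda>\<omega>. Z \<omega> * I d)" by auto
  show "AE \<omega> in M. norm (Z \<omega> * J d y \<omega>) \<le> norm (Z \<omega> * I d)"
    using J_pos[of y] J_le[of y] d I_pos[of d]
    by (intro AE_I2) (simp add: abs_mult mult_left_mono less_imp_le)
qed simp

text \<open>By definition of \<open>V\<close>, \<open>U (I z) = V z + z * I z\<close>. With
  \<open>z = max (y * Z) d \<ge> y * Z\<close> the truncation turns this equality into an inequality
  in the useful direction.\<close>

lemma U_J_bounds:
  assumes "0 \<le> y" "\<omega> \<in> space M"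
  shows "V (max (y * Z \<omega>) d) + y * (Z \<omega> * J d y \<omega>) \<le> U (J d y \<omega>)" "U (J d y \<omega>) \<le> U (I d)"
proof -
  have "y * Z \<omega> * J d y \<omega> \<le> max (y * Z \<omega>) d * J d y \<omega>"
    using J_pos[of y \<omega>] by (intro mult_right_mono) auto
  then show "V (max (y * Z \<omega>) d) + y * (Z \<omega> * J d y \<omega>) \<le> U (J d y \<omega>)"
    by (simp add: V_def J_def)
  show "U (J d y \<omega>) \<le> U (I d)" using J_pos J_le by (rule U_mono)
qed

lemma integrable_U_J: "0 \<le> y \<Longrightarrow> integrable M (\<lambda>\<omega>. U (J d y \<omega>))"
proof -
  assume y: "0 \<le> y"
  show ?thesis
  proof (rule Bochner_Integration.integrable_bound)
    show "integrable M (\<lambda>\<omega>. \<bar>U (I d)\<bar> + \<bar>V (max (y * Z \<omega>) d) + y * (Z \<omega> * J d y \<omega>)\<bar>)"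
      using integrable_V_max[OF y] integrable_Z_J by auto
    show "AE \<omega> in M. norm (U (J d y \<omega>)) \<le> norm (\<bar>U (I d)\<bar> + \<bar>V (max (y * Z \<omega>) d) + y * (Z \<omega> * J d y \<omega>)\<bar>)"
    proof (rule AE_I2)
      fix \<omega> assume \<omega>: "\<omega> \<in> space M"
      show "norm (U (J d y \<omega>)) \<le> norm (\<bar>U (I d)\<bar> + \<bar>V (max (y * Z \<omega>) d) + y * (Z \<omega> * J d y \<omega>)\<bar>)"
        using U_J_bounds[OF y \<omega>] by simp
    qed
  qed (unfold J_def, rule comp_max_measurable[OF U_I_continuous])
qed

lemma expectation_U_J_ge:
  assumes "0 \<le> y"
  shows "expectation (\<lambda>\<omega>. V (max (y * Z \<omega>) d)) + y * expectation (\<lambda>\<omega>. Z \<omega> * J d y \<omega>)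
    \<le> expectation (\<lambda>\<omega>. U (J d y \<omega>))"
proof -
  have "expectation (\<lambda>\<omega>. V (max (y * Z \<omega>) d) + y * (Z \<omega> * J d y \<omega>)) \<le> expectation (\<lambda>\<omega>. U (J d y \<omega>))"
    using U_J_bounds(1)[OF assms] integrable_U_J[OF assms] integrable_V_max[OF assms] integrable_Z_J
    by (intro integral_mono) auto
  then show ?thesis using integrable_V_max[OF assms] integrable_Z_J by simp
qed

lemma budget_tendsto:
  assumes "\<And>\<omega>. \<omega> \<in> space M \<Longrightarrow> (\<lambda>n. J d (y n) \<omega>) \<longlonglongrightarrow> f \<omega>" and [measurable]: "f \<in> borel_measurable M"
  shows "(\<lambda>n::nat. expectation (\<lambda>\<omega>. Z \<omega> * J d (y n) \<omega>)) \<longlonglongrightarrow> expectation (\<lambda>\<omega>. Z \<omega> * f \<omega>)"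
proof (rule integral_dominated_convergence)
  show "integrable M (\<lambda>\<omega>. Z \<omega> * I d)" by auto
  show "AE \<omega> in M. (\<lambda>n. Z \<omega> * J d (y n) \<omega>) \<longlonglongrightarrow> Z \<omega> * f \<omega>"
    using assms(1) by (intro AE_I2 tendsto_mult_left)
  show "AE \<omega> in M. norm (Z \<omega> * J d (y n) \<omega>) \<le> Z \<omega> * I d" for n
    using J_pos[of "y n"] J_le[of "y n"] Z_pos
    by (intro AE_I2) (simp add: abs_mult mult_mono less_imp_le)
qed auto

text \<open>As a function of \<open>y\<close>, the cost starts at \<open>I d\<close> for
  \<open>y = 0\<close> (constant payoff, mean density 1), is continuous, and tends to 0; the
  intermediate value theorem applies.\<close>

lemma ex_budget_eq:
  assumes x: "0 < x" "x < I d"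
  shows "\<exists>y>0. expectation (\<lambda>\<omega>. Z \<omega> * J d y \<omega>) = x"
proof -
  let ?B = "\<lambda>y. expectation (\<lambda>\<omega>. Z \<omega> * J d y \<omega>)"
  have B0: "?B 0 = I d" using d by (simp add: J_def max_def Z_mean)
  have "(\<lambda>n. ?B (real n)) \<longlonglongrightarrow> expectation (\<lambda>\<omega>. Z \<omega> * 0)"
  proof (rule budget_tendsto)
    fix \<omega> assume \<omega>: "\<omega> \<in> space M"
    have "filterlim (\<lambda>n. Z \<omega> * real n) at_top sequentially"
      using Z_pos[OF \<omega>] by (intro filterlim_tendsto_pos_mult_at_top[OF tendsto_const])
        (auto intro: filterlim_real_sequentially)
    then have "filterlim (\<lambda>n. max (real n * Z \<omega>) d) at_top sequentially"
      by (rule filterlim_at_top_mono) (auto simp: mult.commute)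
    then show "(\<lambda>n. J d (real n) \<omega>) \<longlonglongrightarrow> 0"
      unfolding J_def by (rule filterlim_compose[OF I_tendsto_0])
  qed simp
  then have "eventually (\<lambda>n. ?B (real n) < x) sequentially"
    using x by (intro order_tendstoD(2)) auto
  then obtain n where n: "?B (real n) < x" by (auto dest!: eventually_happens)
  have "continuous_on {0..real n} ?B"
  proof (subst continuous_on_sequentially, safe)
    fix a u assume u: "\<forall>k::nat. u k \<in> {0..real n}" "u \<longlonglongrightarrow> a"
    have "(\<lambda>k. ?B (u k)) \<longlonglongrightarrow> ?B a"
    proof (rule budget_tendsto)
      fix \<omega> assume "\<omega> \<in> space M"
      have "(\<lambda>k. max (u k * Z \<omega>) d) \<longlonglongrightarrow> max (a * Z \<omega>) d" by (intro tendsto_intros u(2))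
      from isCont_tendsto_compose[OF _ this, of I]
      show "(\<lambda>k. J d (u k) \<omega>) \<longlonglongrightarrow> J d a \<omega>"
        using d isCont_I unfolding J_def by (simp add: less_max_iff_disj)
    qed simp
    then show "(?B \<circ> u) \<longlonglongrightarrow> ?B a" by (simp add: comp_def)
  qed
  then obtain y where y: "0 \<le> y" "y \<le> real n" "?B y = x"
    using IVT2'[of ?B "real n" x 0] n x B0 by auto
  then have "y \<noteq> 0" using B0 x by auto
  then show ?thesis using y by (intro exI[of _ y]) auto
qed

end

end

section \<open>Absence of a duality gap\<close>

context utility_density
begin

text \<open>
  If all these payoffs had utility at most \<open>c\<close>, the multipliers \<open>y\<close> adapted to budgets tending to
  \<open>x\<close> and cut-offs tending to \<open>0\<close> would stay bounded; a dual value at most about \<open>c\<close> would then be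
  attained just above an accumulation point.
\<close>

lemma ex_near_optimal:
  assumes x: "0 < x" and c: "c < c'"
    and dual: "\<And>y. 0 < y \<Longrightarrow> integrable M (\<lambda>\<omega>. V (y * Z \<omega>)) \<Longrightarrow>
      c' \<le> expectation (\<lambda>\<omega>. V (y * Z \<omega>)) + x * y"
  shows "\<exists>d>0. \<exists>y>0. expectation (\<lambda>\<omega>. Z \<omega> * J d y \<omega>) < x \<and> c < expectation (\<lambda>\<omega>. U (J d y \<omega>))"
proof (rule ccontr)
  assume "\<not> ?thesis"
  then have contra: "expectation (\<lambda>\<omega>. U (J d y \<omega>)) \<le> c"
    if "0 < d" "0 < y" "expectation (\<lambda>\<omega>. Z \<omega> * J d y \<omega>) < x" for d y
    using that by (meson not_less)
  \<comment> \<open>Chosen so that \<open>I d0 = x + 1\<close>: every cut-off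
    \<open>d k \<le> d0\<close> then satisfies \<open>xk k < I (d k)\<close>, as the budget equation
    requires.\<close>
  define d0 where "d0 = deriv U (x + 1)"
  define d where "d k = d0 / real (Suc k)" for k
  \<comment> \<open>Strictly below \<open>x\<close>, so that the contradiction hypothesis applies,
    and at least \<open>x / 2\<close> already for \<open>k = 0\<close>.\<close>
  define xk where "xk k = x - x / real (k + 2)" for k
  have d0: "0 < d0" "I d0 = x + 1"
    unfolding d0_def using x by (auto intro!: deriv_U_pos I_deriv_U)
  have d: "0 < d k" "d k \<le> d0" for k
    using d0 by (auto simp: d_def field_simps)
  have d_mono: "d l \<le> d k" if "k \<le> l" for k l
    using d0 that unfolding d_def by (intro divide_left_mono) auto
  have d_lim: "d \<longlonglongrightarrow> 0"
    unfolding d_def by (rule LIMSEQ_Suc[OF lim_const_over_n])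
  have xk: "x / 2 \<le> xk k" "xk k < x" for k
    using x by (auto simp: xk_def field_simps)
  have xk_lim: "xk \<longlonglongrightarrow> x"
  proof -
    have "(\<lambda>k. x - x / real (k + 2)) \<longlonglongrightarrow> x - 0"
      by (intro tendsto_diff tendsto_const LIMSEQ_ignore_initial_segment[OF lim_const_over_n])
    then show ?thesis by (simp add: xk_def[abs_def])
  qed
  have "\<exists>y>0. expectation (\<lambda>\<omega>. Z \<omega> * J (d k) y \<omega>) = xk k" for k
  proof (rule ex_budget_eq[OF d(1)])
    show "0 < xk k" using xk(1)[of k] x by simp
    have "x + 1 \<le> I (d k)" using I_antimono[OF d, of k] d0 by simp
    then show "xk k < I (d k)" using xk(2)[of k] by simp
  qed
  then obtain y where y: "\<And>k. 0 < y k" and budget: "\<And>k. expectation (\<lambda>\<omega>. Z \<omega> * J (d k) (y k) \<omega>) = xk k"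
    by metis
  define G where "G k t = expectation (\<lambda>\<omega>. V (max (t * Z \<omega>) (d k)))" for k t
  have key: "G k (y k) + y k * xk k \<le> c" for k
    using expectation_U_J_ge[OF d(1), of "y k" k] contra[OF d(1)[of k] y[of k]] y[of k] budget[of k] xk(2)[of k]
    unfolding G_def by simp
  \<comment> \<open>The affine minorant with slope \<open>x / 4\<close> loses
    \<open>x / 4 * y k\<close>, while the budget term gains at least \<open>x / 2 * y k\<close>; the
    surplus bounds \<open>y k\<close>.\<close>
  have y_le: "y k \<le> 4 / x * (c - U (x / 4) + x / 4 * d0)" for k
  proof -
    have "expectation (\<lambda>\<omega>. U (x/4) - x/4 * d k - x/4 * y k * Z \<omega>) \<le> G k (y k)"
      unfolding G_def
      using V_max_bounds(2)[OF d(1), of "y k" _ "x/4" k] y[of k] x integrable_V_max[OF d(1), of "y k" k]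
      by (intro integral_mono) auto
    then have "U (x/4) - x/4 * d k - x/4 * y k \<le> G k (y k)"
      by (simp add: Z_mean prob_space)
    moreover have "y k * (x / 2) \<le> y k * xk k" using xk(1)[of k] y[of k] by (intro mult_left_mono) auto
    moreover have "x / 4 * d k \<le> x / 4 * d0" using d(2)[of k] x by (intro mult_left_mono) auto
    ultimately have "x / 4 * y k \<le> c - U (x/4) + x/4 * d0" using key[of k] by (simp add: mult.commute)
    then show ?thesis using x by (simp add: field_simps)
  qed
  have "bounded (range y)"
    using y_le y by (intro boundedI[of _ "4 / x * (c - U (x / 4) + x / 4 * d0)"]) (auto simp: less_imp_le)
  then obtain l r where r: "strict_mono r" and l: "(y \<circ> r) \<longlonglongrightarrow> l"
    using bounded_imp_convergent_subsequence by blast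
  have l0: "0 \<le> l" using y by (intro LIMSEQ_le_const[OF l]) (auto simp: less_imp_le)
  \<comment> \<open>Strictly above the accumulation point, so that eventually
    \<open>y (r k) < t\<close> and \<open>t > 0\<close> even if \<open>l = 0\<close>; yet raising
    \<open>l\<close> to \<open>t\<close> costs only half of the gap \<open>c' - c\<close>.\<close>
  define t where "t = l + (c' - c) / (2 * x)"
  have t: "l < t" "0 < t" using l0 c x by (auto simp: t_def add_nonneg_pos)
  have G_anti: "G k t \<le> G k s" if "0 < s" "s \<le> t" for k s
    unfolding G_def
  proof (rule integral_mono)
    fix \<omega> assume "\<omega> \<in> space M"
    then have "s * Z \<omega> \<le> t * Z \<omega>" using that(2) Z_pos by (intro mult_right_mono) (auto simp: less_imp_le)
    then show "V (max (t * Z \<omega>) (d k)) \<le> V (max (s * Z \<omega>) (d k))"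
      using d(1)[of k] by (intro V_antimono max.mono) (auto simp: less_max_iff_disj)
  qed (use that t d(1)[of k] in \<open>auto intro!: integrable_V_max\<close>)
  have G_inc: "incseq (\<lambda>k. G (r k) t)"
  proof (rule incseq_SucI)
    fix k
    show "G (r k) t \<le> G (r (Suc k)) t"
      unfolding G_def using t d d_mono[of "r k" "r (Suc k)"] r
      by (intro integral_mono integrable_V_max V_antimono)
         (auto simp: less_max_iff_disj strict_mono_less_eq max.coboundedI2)
  qed
  have ev: "eventually (\<lambda>k. G (r k) t \<le> c - y (r k) * xk (r k)) sequentially"
    using order_tendstoD(2)[OF l t(1)]
  proof eventually_elim
    case (elim k)
    then have "G (r k) t \<le> G (r k) (y (r k))" using y by (intro G_anti) auto
    then show ?case using key[of "r k"] by simp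
  qed
  have G_le: "G (r k) t \<le> c" for k
  proof -
    obtain k0 where k0: "\<And>k. k \<ge> k0 \<Longrightarrow> G (r k) t \<le> c - y (r k) * xk (r k)"
      using ev by (auto simp: eventually_sequentially)
    have "G (r k) t \<le> G (r (max k k0)) t" using G_inc by (rule incseqD) simp
    also have "\<dots> \<le> c - y (r (max k k0)) * xk (r (max k k0))" by (rule k0) simp
    also have "\<dots> \<le> c"
      using y[of "r (max k k0)"] xk(1)[of "r (max k k0)"] x by (simp add: less_imp_le)
    finally show ?thesis .
  qed
  \<comment> \<open>As the cut-offs decrease to 0, the truncated conjugates increase to
    \<open>V (t * Z)\<close>. Monotone convergence with bounded integrals yields its integrability
    too, which \<open>dual\<close> demands.\<close>
  obtain S where S: "(\<lambda>k. G (r k) t) \<longlonglongrightarrow> S"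
    using incseq_convergent[OF G_inc] G_le by blast
  have S': "(\<lambda>k. expectation (\<lambda>\<omega>. V (max (t * Z \<omega>) (d (r k))))) \<longlonglongrightarrow> S"
    using S by (simp add: G_def)
  have mono: "AE \<omega> in M. mono (\<lambda>k. V (max (t * Z \<omega>) (d (r k))))"
    using d d_mono r
    by (intro AE_I2 monoI V_antimono) (auto simp: less_max_iff_disj strict_mono_less_eq max.coboundedI2)
  have lim: "AE \<omega> in M. (\<lambda>k. V (max (t * Z \<omega>) (d (r k)))) \<longlonglongrightarrow> V (t * Z \<omega>)"
  proof (rule AE_I2)
    fix \<omega> assume "\<omega> \<in> space M"
    then have "0 < t * Z \<omega>" using Z_pos t by simp
    then have "eventually (\<lambda>k. d (r k) < t * Z \<omega>) sequentially"
      by (intro order_tendstoD(2)[OF LIMSEQ_subseq_LIMSEQ[OF d_lim r, unfolded comp_def]])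
    then have "eventually (\<lambda>k. V (t * Z \<omega>) = V (max (t * Z \<omega>) (d (r k)))) sequentially"
      by eventually_elim (simp add: max_def)
    then show "(\<lambda>k. V (max (t * Z \<omega>) (d (r k)))) \<longlonglongrightarrow> V (t * Z \<omega>)"
      by (rule Lim_transform_eventually[OF tendsto_const])
  qed
  have meas: "(\<lambda>\<omega>. V (t * Z \<omega>)) \<in> borel_measurable M"
    using Z_pos t by (intro measurable_comp_pos[OF V_continuous]) auto
  note mc = integral_monotone_convergence[OF integrable_V_max[OF d(1)] mono lim S' meas]
    integrable_monotone_convergence[OF integrable_V_max[OF d(1)] mono lim S' meas]
  have "expectation (\<lambda>\<omega>. V (t * Z \<omega>)) = S" "integrable M (\<lambda>\<omega>. V (t * Z \<omega>))"
    using t by (auto intro!: mc)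
  \<comment> \<open>Together with \<open>S \<le> c - l * x\<close> this gives
    \<open>c' \<le> c + (c' - c) / 2\<close>, which is absurd.\<close>
  then have "c' \<le> S + x * t" using dual[OF t(2)] by simp
  moreover have "S \<le> c - l * x"
  proof (rule tendsto_le[OF _ _ S ev])
    show "(\<lambda>k. c - y (r k) * xk (r k)) \<longlonglongrightarrow> c - l * x"
      using l LIMSEQ_subseq_LIMSEQ[OF xk_lim r] by (intro tendsto_intros) (auto simp: comp_def)
  qed simp
  moreover have "x * t = l * x + (c' - c) / 2"
    using x by (simp add: t_def field_simps)
  moreover have "(c' - c) / 2 < c' - c" using c by simp
  ultimately show False by linarith
qed

end

section \<open>Passage to the limit\<close>

lemma real_distribution_std_normal: "real_distribution std_normal_distribution"
  by (rule real_dist_normal_dist)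

definition bs_density :: "real \<Rightarrow> real" where
  "bs_density s = exp (- s / 2 - 1 / 8)"

text \<open>Completing the square: the change of measure shifts the mean to -1/2, so integrability
  and mean 1 are those of a normal density.\<close>

lemma bs_density_times_normal: "std_normal_density s * bs_density s = normal_density (- 1 / 2) 1 s"
proof -
  have "- s\<^sup>2 / 2 + (- s / 2 - 1 / 8) = - (s + 1 / 2)\<^sup>2 / 2"
    by (simp add: power2_eq_square field_simps)
  then show ?thesis
    by (simp add: std_normal_density_def normal_density_def bs_density_def mult_exp_exp)
qed

lemma integrable_bs_density: "integrable std_normal_distribution bs_density"
  and integral_bs_density: "(\<integral>s. bs_density s \<partial>std_normal_distribution) = 1"
proof -
  have [measurable]: "bs_density \<in> borel_measurable borel" unfolding bs_density_def by measurable
  show "integrable std_normal_distribution bs_density"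
    by (subst integrable_density) (auto simp: bs_density_times_normal integrable_normal_density)
  show "(\<integral>s. bs_density s \<partial>std_normal_distribution) = 1"
    by (subst integral_density) (auto simp: bs_density_times_normal integral_normal_density)
qed

section \<open>Comparison of tails and of integrals\<close>

lemma measure_std_normal_interval_ge:
  assumes uv: "u \<le> v" and m: "\<And>s. u \<le> s \<Longrightarrow> s \<le> v \<Longrightarrow> m \<le> std_normal_density s"
  shows "(v - u) * m \<le> measure std_normal_distribution {u..v}"
proof -
  interpret real_distribution std_normal_distribution by (rule real_distribution_std_normal)
  have "ennreal ((v - u) * m) = ennreal m * emeasure lborel {u..v}" if "0 \<le> m"
    using uv that by (simp add: ennreal_mult' mult.commute)
  also have "ennreal m * emeasure lborel {u..v} = (\<integral>\<^sup>+ s. ennreal m * indicator {u..v} s \<partial>lborel)"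
    by (simp add: nn_integral_cmult_indicator)
  also have "\<dots> \<le> (\<integral>\<^sup>+ s. ennreal (std_normal_density s) * indicator {u..v} s \<partial>lborel)"
    using m by (intro nn_integral_mono) (auto intro!: ennreal_leI split: split_indicator)
  also have "\<dots> = emeasure std_normal_distribution {u..v}"
    by (simp add: emeasure_density)
  finally have "0 \<le> m \<Longrightarrow> ennreal ((v - u) * m) \<le> emeasure std_normal_distribution {u..v}" .
  then have "0 \<le> m \<Longrightarrow> (v - u) * m \<le> measure std_normal_distribution {u..v}"
    by (simp add: emeasure_eq_measure)
  moreover have "(v - u) * m \<le> 0" if "m < 0"
    using uv that by (simp add: mult_nonneg_nonpos)
  ultimately show ?thesis
    using measure_nonneg[of std_normal_distribution "{u..v}"] by linarith
qed

text \<open>The normal tail at \<open>r\<close> is smaller than \<open>exp (- r\<^sup>2 / 2)\<close>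
  by a factor of order \<open>1/r\<close>. Moving the threshold down by a fixed
  \<open>\<eta>\<close> makes up for it: an interval of length \<open>\<eta> / 2\<close> ending at
  \<open>r\<close> alone has mass of the required order.\<close>

lemma std_normal_tail_ge:
  fixes \<eta> :: real
  assumes \<eta>: "0 < \<eta>"
  shows "\<exists>C>0. \<forall>r. exp (- (max r 0)\<^sup>2 / 2) \<le> C * measure std_normal_distribution {r - \<eta><..}"
proof -
  interpret real_distribution std_normal_distribution by (rule real_distribution_std_normal)
  define c where "c = 1 / sqrt (2 * pi)"
  have c: "0 < c" by (simp add: c_def)
  have dens: "std_normal_density s = c * exp (- s\<^sup>2 / 2)" for s
    by (simp add: std_normal_density_def c_def)
  \<comment> \<open>The entries are the reciprocals of the two lower bounds below: length 1/2 times
    the density at 1, and length \<open>\<eta> / 2\<close> times \<open>c\<close>.\<close>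
  define C where "C = max (2 / (c * exp (-1/2))) (2 / (c * \<eta>))"
  have C: "0 < C" "1 \<le> C * (1/2 * (c * exp (-1/2)))" "1 \<le> C * (\<eta> / 2 * c)"
  proof -
    show "0 < C" unfolding C_def using c by (simp add: less_max_iff_disj)
    have "2 / (c * exp (-1/2)) \<le> C" "2 / (c * \<eta>) \<le> C" by (simp_all add: C_def)
    then show "1 \<le> C * (1/2 * (c * exp (-1/2)))" "1 \<le> C * (\<eta> / 2 * c)"
      using c \<eta> by (simp_all add: field_simps)
  qed
  have "exp (- (max r 0)\<^sup>2 / 2) \<le> C * measure std_normal_distribution {r - \<eta><..}" for r
  \<comment> \<open>For \<open>r \<le> \<eta>\<close> the tail contains the fixed interval from 1/2
    to 1. Otherwise the interval from \<open>r - \<eta> / 2\<close> to \<open>r\<close> is positive,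
    so the density is smallest at \<open>r\<close>.\<close>
  proof (cases "r \<le> \<eta>")
    case True
    have "(1 - 1/2) * (c * exp (-1/2)) \<le> measure std_normal_distribution {1/2..1}"
      using c by (intro measure_std_normal_interval_ge) (auto simp: dens power_le_one_iff)
    also have "\<dots> \<le> measure std_normal_distribution {r - \<eta><..}"
      using True by (intro finite_measure_mono) auto
    finally have "C * (1/2 * (c * exp (-1/2))) \<le> C * measure std_normal_distribution {r - \<eta><..}"
      using C(1) by (intro mult_left_mono) auto
    moreover have "exp (- (max r 0)\<^sup>2 / 2) \<le> 1" by simp
    ultimately show ?thesis using C(2) by linarith
  next
    case False
    have "(r - (r - \<eta> / 2)) * (c * exp (- r\<^sup>2 / 2)) \<le> measure std_normal_distribution {r - \<eta> / 2..r}"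
      using c False \<eta> by (intro measure_std_normal_interval_ge) (auto simp: dens power2_le_iff_abs_le abs_le_iff)
    also have "\<dots> \<le> measure std_normal_distribution {r - \<eta><..}"
      using \<eta> by (intro finite_measure_mono) auto
    finally have le: "\<eta> / 2 * (c * exp (- r\<^sup>2 / 2)) \<le> measure std_normal_distribution {r - \<eta><..}"
      by simp
    have "1 * exp (- r\<^sup>2 / 2) \<le> C * (\<eta> / 2 * c) * exp (- r\<^sup>2 / 2)"
      using C(3) by (intro mult_right_mono) auto
    also have "\<dots> = C * (\<eta> / 2 * (c * exp (- r\<^sup>2 / 2)))" by (simp only: mult.assoc)
    also have "\<dots> \<le> C * measure std_normal_distribution {r - \<eta><..}"
      using C(1) le by (intro mult_left_mono) auto
    finally show ?thesis using False \<eta> by (simp add: max_def)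
  qed
  then show ?thesis using C(1) by blast
qed

text \<open>Layer-cake formula by Fubini. Only levels \<open>t \<ge> 0\<close> count because
  \<open>ennreal\<close> cuts off the negative part of \<open>f\<close>.\<close>

lemma nn_integral_eq_levels:
  fixes f :: "'a \<Rightarrow> real"
  assumes "sigma_finite_measure M" and [measurable]: "f \<in> borel_measurable M"
  shows "(\<integral>\<^sup>+ x. ennreal (f x) \<partial>M) =
    (\<integral>\<^sup>+ t. indicator {0..} t * emeasure M {x \<in> space M. t < f x} \<partial>lborel)"
proof -
  interpret sigma_finite_measure M by fact
  interpret pair_sigma_finite M "lborel :: real measure" ..
  have "(\<integral>\<^sup>+ x. ennreal (f x) \<partial>M) = (\<integral>\<^sup>+ x. (\<integral>\<^sup>+ t. indicator {0..} t * indicator {x \<in> space M. t < f x} x \<partial>lborel) \<partial>M)"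
  proof (rule nn_integral_cong)
    fix x assume x: "x \<in> space M"
    have "(\<integral>\<^sup>+ t. indicator {0..} t * indicator {x \<in> space M. t < f x} x \<partial>lborel) =
        (\<integral>\<^sup>+ t. indicator {0..<f x} t \<partial>lborel)"
      using x by (intro nn_integral_cong) (auto split: split_indicator)
    also have "\<dots> = ennreal (f x)"
      by (cases "0 \<le> f x") (auto simp: ennreal_neg)
    finally show "ennreal (f x) = (\<integral>\<^sup>+ t. indicator {0..} t * indicator {x \<in> space M. t < f x} x \<partial>lborel)" ..
  qed
  also have "\<dots> = (\<integral>\<^sup>+ t. (\<integral>\<^sup>+ x. indicator {0..} t * indicator {x \<in> space M. t < f x} x \<partial>M) \<partial>lborel)"
  proof (rule Fubini'[symmetric])
    have "(\<lambda>(x, t). indicator {0..} t * indicator {p \<in> space (M \<Otimes>\<^sub>M lborel). snd p < f (fst p)} (x, t) :: ennreal)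
        \<in> borel_measurable (M \<Otimes>\<^sub>M lborel)"
      by measurable
    then show "(\<lambda>(x, t). indicator {0..} t * indicator {x \<in> space M. t < f x} x :: ennreal)
        \<in> borel_measurable (M \<Otimes>\<^sub>M lborel)"
      by (rule measurable_cong[THEN iffD1, rotated])
         (auto simp: space_pair_measure split: split_indicator)
  qed
  also have "\<dots> = (\<integral>\<^sup>+ t. indicator {0..} t * emeasure M {x \<in> space M. t < f x} \<partial>lborel)"
    by (intro nn_integral_cong) (subst nn_integral_cmult, auto)
  finally show ?thesis .
qed

text \<open>Superlevel sets of a nonincreasing \<open>g\<close> are initial segments of the positive
  axis, so the tail hypothesis compares them level by level. It has \<open>\<le>\<close> on one side
  and \<open><\<close> on the other because the segment may or may not contain its endpoint.\<close>

lemma nn_integral_antimono_le: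
  fixes g :: "real \<Rightarrow> real"
  assumes "prob_space M1" "prob_space M2" and C: "1 \<le> C"
    and [measurable]: "Z1 \<in> borel_measurable M1" "Z2 \<in> borel_measurable M2"
    and pos: "\<And>x. x \<in> space M1 \<Longrightarrow> 0 < Z1 x" "\<And>x. x \<in> space M2 \<Longrightarrow> 0 < Z2 x"
    and tail: "\<And>z. 0 < z \<Longrightarrow> measure M1 {x \<in> space M1. Z1 x \<le> z} \<le> C * measure M2 {x \<in> space M2. Z2 x < z}"
    and g: "continuous_on {0<..} g" "\<And>z w. 0 < z \<Longrightarrow> z \<le> w \<Longrightarrow> g w \<le> g z"
  shows "(\<integral>\<^sup>+ x. ennreal (g (Z1 x)) \<partial>M1) \<le> ennreal C * (\<integral>\<^sup>+ x. ennreal (g (Z2 x)) \<partial>M2)"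
proof -
  interpret M1: prob_space M1 by fact
  interpret M2: prob_space M2 by fact
  have meas [measurable]: "(\<lambda>x. g (Z1 x)) \<in> borel_measurable M1" "(\<lambda>x. g (Z2 x)) \<in> borel_measurable M2"
    using pos by (auto intro!: measurable_comp_pos[OF g(1)])
  have level: "measure M1 {x \<in> space M1. t < g (Z1 x)} \<le> C * measure M2 {x \<in> space M2. t < g (Z2 x)}" for t
  proof -
    define A where "A = {z. 0 < z \<and> t < g z}"
    \<comment> \<open>In the middle case \<open>Sup A\<close> serves as \<open>z\<close>. If
      \<open>A\<close> is unbounded it is the whole positive axis, and \<open>C \<ge> 1\<close>
      settles the claim.\<close>
    consider "A = {}" | "A \<noteq> {}" "bdd_above A" | "\<not> bdd_above A" by metis
    then show ?thesis
    proof cases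
      case 1
      then have "{x \<in> space M1. t < g (Z1 x)} = {}" using pos(1) by (auto simp: A_def)
      then show ?thesis using C by (simp only: measure_empty) simp
    next
      case 2
      then obtain z0 where z0: "z0 \<in> A" by blast
      have "0 < Sup A" using cSup_upper[OF z0 2(2)] z0 by (simp add: A_def)
      have "measure M1 {x \<in> space M1. t < g (Z1 x)} \<le> measure M1 {x \<in> space M1. Z1 x \<le> Sup A}"
        using cSup_upper[OF _ 2(2)] pos(1) by (intro M1.finite_measure_mono) (auto simp: A_def)
      also have "\<dots> \<le> C * measure M2 {x \<in> space M2. Z2 x < Sup A}" by (rule tail) fact
      also have "\<dots> \<le> C * measure M2 {x \<in> space M2. t < g (Z2 x)}"
      proof (intro mult_left_mono M2.finite_measure_mono)
        show "{x \<in> space M2. Z2 x < Sup A} \<subseteq> {x \<in> space M2. t < g (Z2 x)}"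
        proof safe
          fix x assume x: "x \<in> space M2" "Z2 x < Sup A"
          then obtain z where "z \<in> A" "Z2 x < z" using less_cSup_iff[OF 2] by blast
          then show "t < g (Z2 x)" using g(2)[of "Z2 x" z] pos(2)[OF x(1)] by (simp add: A_def)
        qed
      qed (use C in auto)
      finally show ?thesis .
    next
      case 3
      have "{x \<in> space M2. t < g (Z2 x)} = space M2"
      proof safe
        fix x assume x: "x \<in> space M2"
        obtain z where "z \<in> A" "Z2 x < z" using 3 by (meson bdd_above.I not_less)
        then show "t < g (Z2 x)" using g(2)[of "Z2 x" z] pos(2)[OF x] by (simp add: A_def)
      qed
      then have "measure M2 {x \<in> space M2. t < g (Z2 x)} = 1" by (simp add: M2.prob_space)
      then show ?thesis using order_trans[OF M1.prob_le_1 C] by simp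
    qed
  qed
  have "(\<integral>\<^sup>+ x. ennreal (g (Z1 x)) \<partial>M1) \<le>
      (\<integral>\<^sup>+ t. ennreal C * (indicator {0..} t * emeasure M2 {x \<in> space M2. t < g (Z2 x)}) \<partial>lborel)"
  proof (subst nn_integral_eq_levels[OF M1.sigma_finite_measure_axioms meas(1)], rule nn_integral_mono)
    fix t :: real
    have "emeasure M1 {x \<in> space M1. t < g (Z1 x)} \<le> ennreal C * emeasure M2 {x \<in> space M2. t < g (Z2 x)}"
      using level[of t] C
      by (simp add: M1.emeasure_eq_measure M2.emeasure_eq_measure ennreal_mult'[symmetric] ennreal_leI)
    then show "indicator {0..} t * emeasure M1 {x \<in> space M1. t < g (Z1 x)}
        \<le> ennreal C * (indicator {0..} t * emeasure M2 {x \<in> space M2. t < g (Z2 x)})"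
      by (auto split: split_indicator)
  qed
  also have "\<dots> = ennreal C * (\<integral>\<^sup>+ x. ennreal (g (Z2 x)) \<partial>M2)"
    unfolding nn_integral_eq_levels[OF M2.sigma_finite_measure_axioms meas(2)]
    by (rule nn_integral_cmult) measurable
  finally show ?thesis .
qed

text \<open>Skorohod's representation turns weak convergence into pointwise convergence of the
  densities, and Fatou applies to \<open>g\<close> raised by an affine function. Since all densities
  have mean 1, that correction integrates to \<open>K + L\<close> for every \<open>n\<close> and in
  the limit, and cancels. Upper bounds come from the same lemma applied to
  \<open>- g\<close>.\<close>

lemma expectation_liminf:
  fixes \<mu> :: "nat \<Rightarrow> real measure" and g :: "real \<Rightarrow> real"
  assumes \<mu>: "\<And>n. real_distribution (\<mu> n)" "weak_conv_m \<mu> std_normal_distribution"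
    and a: "a \<longlonglongrightarrow> 1 / 2" and b: "b \<longlonglongrightarrow> 1 / 8"
    and D_int: "\<And>n. integrable (\<mu> n) (\<lambda>s. exp (- a n * s - b n))"
    and D_mean: "\<And>n. (\<integral>s. exp (- a n * s - b n) \<partial>\<mu> n) = 1"
    and g: "continuous_on {0<..} g" and lower: "\<And>z. 0 < z \<Longrightarrow> - (K + L * z) \<le> g z"
    and g_int: "\<And>n. integrable (\<mu> n) (\<lambda>s. g (exp (- a n * s - b n)))"
      "integrable std_normal_distribution (\<lambda>s. g (bs_density s))"
    and c: "c < (\<integral>s. g (bs_density s) \<partial>std_normal_distribution)"
  shows "eventually (\<lambda>n. c < (\<integral>s. g (exp (- a n * s - b n)) \<partial>\<mu> n)) sequentially"
proof -
  obtain \<Omega> :: "real measure" and Y :: "nat \<Rightarrow> real \<Rightarrow> real" and Y' where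
    \<Omega>: "prob_space \<Omega>" and Y [measurable]: "\<And>n. Y n \<in> measurable \<Omega> borel"
    and Y_distr: "\<And>n. distr \<Omega> borel (Y n) = \<mu> n"
    and Y'': "Y' \<in> measurable \<Omega> lborel" and Y'_distr: "distr \<Omega> borel Y' = std_normal_distribution"
    and Y_lim: "\<And>\<omega>. \<omega> \<in> space \<Omega> \<Longrightarrow> (\<lambda>n. Y n \<omega>) \<longlonglongrightarrow> Y' \<omega>"
    using Skorohod[OF \<mu>(1) real_distribution_std_normal \<mu>(2)] by blast
  have Y' [measurable]: "Y' \<in> borel_measurable \<Omega>" using Y'' by simp
  interpret \<Omega>: prob_space \<Omega> by fact
  define h where "h z = g z + K + L * z" for z
  have h0: "0 \<le> h z" if "0 < z" for z using lower[OF that] by (simp add: h_def)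
  have h_cont: "continuous_on {0<..} h" unfolding h_def by (intro continuous_intros g)
  define Dn where "Dn n s = exp (- a n * s - b n)" for n s
  have [measurable]: "Dn n \<in> borel_measurable borel" for n unfolding Dn_def by measurable
  have [measurable]: "bs_density \<in> borel_measurable borel" unfolding bs_density_def by measurable
  have Dn_pos: "0 < Dn n s" and bs_pos: "0 < bs_density s" for n s by (auto simp: Dn_def bs_density_def)
  have g_comp [measurable]: "(\<lambda>s. g (Dn n s)) \<in> borel_measurable borel" "(\<lambda>s. g (bs_density s)) \<in> borel_measurable borel"
    "(\<lambda>s. h (Dn n s)) \<in> borel_measurable borel" "(\<lambda>s. h (bs_density s)) \<in> borel_measurable borel" for n
    using Dn_pos bs_pos by (auto intro!: measurable_comp_pos[OF g] measurable_comp_pos[OF h_cont])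
  have lim: "(\<lambda>n. h (Dn n (Y n \<omega>))) \<longlonglongrightarrow> h (bs_density (Y' \<omega>))" if "\<omega> \<in> space \<Omega>" for \<omega>
  proof -
    have "(\<lambda>n. - a n * Y n \<omega> - b n) \<longlonglongrightarrow> - (1/2) * Y' \<omega> - 1/8"
      by (intro tendsto_intros a b Y_lim that)
    then have "(\<lambda>n. exp (- a n * Y n \<omega> - b n)) \<longlonglongrightarrow> exp (- (1/2) * Y' \<omega> - 1/8)"
      by (rule tendsto_exp)
    then have 1: "(\<lambda>n. Dn n (Y n \<omega>)) \<longlonglongrightarrow> bs_density (Y' \<omega>)"
      by (simp add: Dn_def bs_density_def)
    show ?thesis
      by (rule continuous_on_tendsto_compose[OF h_cont 1]) (auto simp: Dn_pos bs_pos)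
  qed
  define G where "G = (\<integral>s. g (bs_density s) \<partial>std_normal_distribution)"
  define Gn where "Gn n = (\<integral>s. g (Dn n s) \<partial>\<mu> n)" for n
  have nn: "(\<integral>\<^sup>+ \<omega>. ennreal (h (Dn n (Y n \<omega>))) \<partial>\<Omega>) = ennreal (Gn n + K + L)" for n
  proof -
    interpret \<mu>: real_distribution "\<mu> n" by (rule \<mu>)
    have "(\<integral>\<^sup>+ \<omega>. ennreal (h (Dn n (Y n \<omega>))) \<partial>\<Omega>) = (\<integral>\<^sup>+ s. ennreal (h (Dn n s)) \<partial>distr \<Omega> borel (Y n))"
      by (subst nn_integral_distr) auto
    also have "\<dots> = ennreal (\<integral>s. h (Dn n s) \<partial>\<mu> n)"
      unfolding Y_distr using g_int(1)[of n] D_int[of n] h0[OF Dn_pos]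
      by (intro nn_integral_eq_integral) (auto simp: h_def Dn_def)
    also have "(\<integral>s. h (Dn n s) \<partial>\<mu> n) = Gn n + K + L"
      using g_int(1)[of n] D_int[of n] D_mean[of n] \<mu>.prob_space unfolding h_def Gn_def Dn_def by simp
    finally show ?thesis .
  qed
  have nn': "(\<integral>\<^sup>+ \<omega>. ennreal (h (bs_density (Y' \<omega>))) \<partial>\<Omega>) = ennreal (G + K + L)"
  proof -
    interpret \<mu>: real_distribution std_normal_distribution by (rule real_distribution_std_normal)
    have "(\<integral>\<^sup>+ \<omega>. ennreal (h (bs_density (Y' \<omega>))) \<partial>\<Omega>) = (\<integral>\<^sup>+ s. ennreal (h (bs_density s)) \<partial>distr \<Omega> borel Y')"
      by (subst nn_integral_distr) auto
    also have "\<dots> = ennreal (\<integral>s. h (bs_density s) \<partial>std_normal_distribution)"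
      unfolding Y'_distr using g_int(2) integrable_bs_density h0[OF bs_pos]
      by (intro nn_integral_eq_integral) (auto simp: h_def)
    also have "(\<integral>s. h (bs_density s) \<partial>std_normal_distribution) = G + K + L"
      using g_int(2) integrable_bs_density integral_bs_density \<mu>.prob_space unfolding h_def G_def by simp
    finally show ?thesis .
  qed
  have "ennreal (G + K + L) = (\<integral>\<^sup>+ \<omega>. liminf (\<lambda>n. ennreal (h (Dn n (Y n \<omega>)))) \<partial>\<Omega>)"
    unfolding nn'[symmetric]
    by (intro nn_integral_cong lim_imp_Liminf[symmetric] tendsto_ennrealI lim) auto
  also have "\<dots> \<le> liminf (\<lambda>n. ennreal (Gn n + K + L))"
    unfolding nn[symmetric] by (rule nn_integral_liminf) measurable
  finally have fatou: "ennreal (G + K + L) \<le> liminf (\<lambda>n. ennreal (Gn n + K + L))" .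
  have Gn0: "0 \<le> Gn n + K + L" for n
  proof -
    interpret \<mu>: real_distribution "\<mu> n" by (rule \<mu>)
    have "0 \<le> (\<integral>s. h (Dn n s) \<partial>\<mu> n)" using h0[OF Dn_pos] by simp
    also have "\<dots> = Gn n + K + L"
      using g_int(1)[of n] D_int[of n] D_mean[of n] \<mu>.prob_space unfolding h_def Gn_def Dn_def by simp
    finally show ?thesis .
  qed
  have cG: "c < G" using c by (simp add: G_def)
  have "eventually (\<lambda>n. c < Gn n) sequentially"
  \<comment> \<open>For a negative level \<open>ennreal\<close> would lose information, but then
    \<open>c < Gn n\<close> holds for all \<open>n\<close> because
    \<open>Gn n + K + L \<ge> 0\<close>.\<close>
  proof (cases "0 \<le> c + K + L")
    case True
    then have "ennreal (c + K + L) < ennreal (G + K + L)" using cG by (intro ennreal_lessI) auto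
    then have "ennreal (c + K + L) < liminf (\<lambda>n. ennreal (Gn n + K + L))" using fatou by (rule less_le_trans)
    then have "eventually (\<lambda>n. ennreal (c + K + L) < ennreal (Gn n + K + L)) sequentially"
      by (rule less_LiminfD)
    then show ?thesis
      by eventually_elim (use True in \<open>simp add: ennreal_less_iff\<close>)
  next
    case False
    then have "c < Gn n" for n using Gn0[of n] by simp
    then show ?thesis by simp
  qed
  then show ?thesis by (simp add: Gn_def Dn_def)
qed

text \<open>Small values of the density are large values of \<open>s\<close>:
  \<open>z = exp (- L)\<close> corresponds to the threshold \<open>(L - b n) / a n\<close>, which is
  at least \<open>r = 2 * (L - b n)\<close> for \<open>r \<ge> 0\<close> because
  \<open>a n \<le> 1/2\<close>. The Chernoff bound at \<open>r\<close> is then compared with a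
  shifted normal tail.\<close>

lemma density_tail_dominated:
  fixes \<mu> :: "nat \<Rightarrow> real measure"
  assumes \<mu>: "\<And>n. real_distribution (\<mu> n)"
    and a: "a \<longlonglongrightarrow> 1 / 2" "\<And>n. a n \<le> 1 / 2" and b: "b \<longlonglongrightarrow> 1 / 8"
    and chernoff: "\<And>n s. 0 \<le> s \<Longrightarrow> measure (\<mu> n) {s..} \<le> exp (- s\<^sup>2 / 2)"
    and l: "1 < l"
  shows "\<exists>C\<ge>1. eventually (\<lambda>n. \<forall>z>0. measure (\<mu> n) {s. exp (- a n * s - b n) \<le> z}
    \<le> C * measure std_normal_distribution {s. bs_density s < l * z}) sequentially"
proof -
  interpret N: real_distribution std_normal_distribution by (rule real_distribution_std_normal)
  define \<eta> where "\<eta> = ln l"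
  have \<eta>: "0 < \<eta>" using l by (simp add: \<eta>_def)
  obtain C where C: "0 < C" "\<And>r. exp (- (max r 0)\<^sup>2 / 2) \<le> C * measure std_normal_distribution {r - \<eta><..}"
    using std_normal_tail_ge[OF \<eta>] by blast
  have C1: "1 \<le> C"
  proof -
    have "1 \<le> C * measure std_normal_distribution {0 - \<eta><..}" using C(2)[of 0] by simp
    also have "\<dots> \<le> C * 1" using C(1) by (intro mult_left_mono N.prob_le_1) auto
    finally show ?thesis by simp
  qed
  have "eventually (\<lambda>n. 0 < a n) sequentially" by (rule order_tendstoD(1)[OF a(1)]) simp
  \<comment> \<open>The factor \<open>l = exp \<eta>\<close> moves the limiting threshold by
    \<open>2 * \<eta>\<close>. One \<open>\<eta>\<close> pays for the normal tail comparison, the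
    other for \<open>2 * (b n - 1/8)\<close>.\<close>
  moreover have "eventually (\<lambda>n. b n < 1/8 + \<eta> / 2) sequentially"
    by (rule order_tendstoD(2)[OF b]) (use \<eta> in simp)
  ultimately have "eventually (\<lambda>n. \<forall>z>0. measure (\<mu> n) {s. exp (- a n * s - b n) \<le> z}
    \<le> C * measure std_normal_distribution {s. bs_density s < l * z}) sequentially"
  proof eventually_elim
    case (elim n)
    interpret \<mu>: real_distribution "\<mu> n" by (rule \<mu>)
    show ?case
    proof (intro allI impI)
      fix z :: real assume z: "0 < z"
      define L where "L = - ln z"
      define r where "r = 2 * (L - b n)"
      have set1: "{s. exp (- a n * s - b n) \<le> z} = {(L - b n) / a n..}"
      proof -
        have "exp (- a n * s - b n) \<le> z \<longleftrightarrow> (L - b n) / a n \<le> s" for s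
        proof -
          have "exp (- a n * s - b n) \<le> z \<longleftrightarrow> - a n * s - b n \<le> ln z"
            using ln_ge_iff[OF z] by simp
          also have "\<dots> \<longleftrightarrow> L - b n \<le> s * a n"
            unfolding L_def by (simp add: algebra_simps) linarith
          also have "\<dots> \<longleftrightarrow> (L - b n) / a n \<le> s"
            using pos_divide_le_eq[OF elim(1)] by simp
          finally show ?thesis .
        qed
        then show ?thesis by auto
      qed
      have "measure (\<mu> n) {(L - b n) / a n..} \<le> exp (- (max r 0)\<^sup>2 / 2)"
      proof (cases "0 \<le> r")
        case True
        have "r \<le> (L - b n) / a n"
        proof -
          have "a n * r \<le> 1/2 * r" using True a(2) by (intro mult_right_mono) auto
          then show ?thesis using elim(1) by (simp add: r_def field_simps)
        qed
        then have "measure (\<mu> n) {(L - b n) / a n..} \<le> measure (\<mu> n) {r..}"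
          by (intro \<mu>.finite_measure_mono) auto
        also have "\<dots> \<le> exp (- r\<^sup>2 / 2)" using True by (rule chernoff)
        finally show ?thesis using True by (simp add: max_def)
      next
        case False
        then show ?thesis by (simp add: max_def)
      qed
      also have "\<dots> \<le> C * measure std_normal_distribution {r - \<eta><..}" by (rule C)
      also have "\<dots> \<le> C * measure std_normal_distribution {s. bs_density s < l * z}"
      proof (intro mult_left_mono N.finite_measure_mono)
        show "{r - \<eta><..} \<subseteq> {s. bs_density s < l * z}"
        proof safe
          fix s assume "s > r - \<eta>"
          then have "- s / 2 - 1/8 < \<eta> - L" using elim(2) by (simp add: r_def)
          then have "exp (- s / 2 - 1/8) < exp (\<eta> - L)" by simp
          also have "exp (\<eta> - L) = l * z" using l z by (simp add: \<eta>_def L_def exp_add)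
          finally show "bs_density s < l * z" by (simp add: bs_density_def)
        qed
        show "{s. bs_density s < l * z} \<in> N.events" unfolding bs_density_def by measurable
      qed (use C in auto)
      finally show "measure (\<mu> n) {s. exp (- a n * s - b n) \<le> z}
        \<le> C * measure std_normal_distribution {s. bs_density s < l * z}"
        unfolding set1 .
    qed
  qed
  then show ?thesis using C1 by blast
qed

section \<open>The binomial models\<close>

text \<open>Independence of coordinate \<open>k\<close> from any function that ignores it; the form
  needed for a one-step martingale identity.\<close>

lemma integral_Pi_pmf_coordinate:
  fixes F :: "('i \<Rightarrow> 'b) \<Rightarrow> real" and G :: "'b \<Rightarrow> real"
  assumes A: "finite A" "k \<in> A" and fin: "\<And>i. i \<in> A \<Longrightarrow> finite (set_pmf (q i))"
    and F: "\<And>f y. F (f(k := y)) = F f"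
  shows "measure_pmf.expectation (Pi_pmf A d q) (\<lambda>f. F f * G (f k)) =
    measure_pmf.expectation (q k) G * measure_pmf.expectation (Pi_pmf (A - {k}) d q) F"
proof -
  let ?B = "A - {k}"
  have fB: "finite (set_pmf (Pi_pmf ?B d q))"
    using A fin by (intro finite_subset[OF set_Pi_pmf_subset'] finite_PiE_dflt) auto
  have fk: "finite (set_pmf (q k))" using A fin by blast
  have "Pi_pmf A d q = map_pmf (\<lambda>(y, f). f(k := y)) (pair_pmf (q k) (Pi_pmf ?B d q))"
    using Pi_pmf_insert[of ?B k d q] A by (simp add: insert_absorb)
  then have "measure_pmf.expectation (Pi_pmf A d q) (\<lambda>f. F f * G (f k)) =
    measure_pmf.expectation (pair_pmf (q k) (Pi_pmf ?B d q)) (\<lambda>(y, f). F f * G y)"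
    by (simp add: case_prod_unfold F)
  also have "\<dots> = (\<Sum>(y, f)\<in>set_pmf (q k) \<times> set_pmf (Pi_pmf ?B d q). (F f * G y) * (pmf (q k) y * pmf (Pi_pmf ?B d q) f))"
    using fB fk by (subst integral_measure_pmf_real[of "set_pmf (q k) \<times> set_pmf (Pi_pmf ?B d q)"])
      (auto simp: case_prod_unfold pmf_pair intro!: sum.cong)
  also have "\<dots> = (\<Sum>y\<in>set_pmf (q k). G y * pmf (q k) y) * (\<Sum>f\<in>set_pmf (Pi_pmf ?B d q). F f * pmf (Pi_pmf ?B d q) f)"
    by (simp add: sum_product sum.cartesian_product mult_ac)
  also have "\<dots> = measure_pmf.expectation (q k) G * measure_pmf.expectation (Pi_pmf ?B d q) F"
    using fB fk by (simp add: integral_measure_pmf_real)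
  finally show ?thesis .
qed

locale binomial_model =
  fixes p :: real
  assumes p_ge: "1 / 2 \<le> p" and p_less: "p < 1"
begin

lemma p_pos: "0 < p" using p_ge by simp

text \<open>\<open>binom_zeta\<close> takes the values \<open>zu\<close> and \<open>- zd\<close>;
  \<open>p \<ge> 1/2\<close> enters the asymptotics as \<open>zu \<le> zd\<close>.\<close>

definition zu :: real where "zu = (1 - p) / sqrt (p * (1 - p))"
definition zd :: real where "zd = p / sqrt (p * (1 - p))"

lemma sd_pos: "0 < sqrt (p * (1 - p))" using p_pos p_less by simp

lemma zu_pos: "0 < zu" and zd_pos: "0 < zd" and zu_le_zd: "zu \<le> zd"
  and zu_zd: "(zu + zd) * sqrt (p * (1 - p)) = 1"
  and zu_eq: "zu = (1 - p) * (zu + zd)" and zd_eq: "zd = p * (zu + zd)"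
  using sd_pos p_pos p_less p_ge unfolding zu_def zd_def by (auto simp: field_simps)

lemma zeta_eq: "binom_zeta p b = (if b then zu else - zd)"
  by (simp add: binom_zeta_def zu_def zd_def)

lemma zu_zd_sq: "(zu + zd)\<^sup>2 * (p * (1 - p)) = 1"
proof -
  have "((zu + zd) * sqrt (p * (1 - p)))\<^sup>2 = (zu + zd)\<^sup>2 * (p * (1 - p))"
    using p_pos p_less by (simp add: power_mult_distrib)
  then show ?thesis by (simp add: zu_zd)
qed

definition up :: "nat \<Rightarrow> real" where "up n = zu / sqrt (real n)"
definition dn :: "nat \<Rightarrow> real" where "dn n = zd / sqrt (real n)"
text \<open>The risk-neutral probability of an up-move, the solution of
  \<open>q * exp (up n) + (1 - q) * exp (- dn n) = 1\<close>.\<close>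

definition pst :: "nat \<Rightarrow> real" where "pst n = (1 - exp (- dn n)) / (exp (up n) - exp (- dn n))"

context
  fixes n :: nat
  assumes n: "0 < n"
begin

lemma up_pos: "0 < up n" and dn_pos: "0 < dn n" and up_le_dn: "up n \<le> dn n"
  using zu_pos zd_pos zu_le_zd n by (auto simp: up_def dn_def divide_right_mono)

lemma exp_diff_pos: "0 < exp (up n) - exp (- dn n)"
  using up_pos dn_pos by simp

lemma one_minus_pst: "1 - pst n = (exp (up n) - 1) / (exp (up n) - exp (- dn n))"
  using exp_diff_pos by (simp add: pst_def field_simps)

lemma pst_pos: "0 < pst n" and pst_less: "pst n < 1"
proof -
  show "0 < pst n" unfolding pst_def using exp_diff_pos dn_pos by (intro divide_pos_pos) auto
  have "0 < 1 - pst n" unfolding one_minus_pst using exp_diff_pos up_pos by (intro divide_pos_pos) auto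
  then show "pst n < 1" by simp
qed

lemma pst_martingale: "pst n * exp (up n) + (1 - pst n) * exp (- dn n) = 1"
proof -
  have "pst n * exp (up n) + (1 - pst n) * exp (- dn n) =
      ((1 - exp (- dn n)) * exp (up n) + (exp (up n) - 1) * exp (- dn n)) / (exp (up n) - exp (- dn n))"
    unfolding one_minus_pst unfolding pst_def by (simp add: add_divide_distrib)
  also have "(1 - exp (- dn n)) * exp (up n) + (exp (up n) - 1) * exp (- dn n) = exp (up n) - exp (- dn n)"
    by (simp add: algebra_simps)
  finally show ?thesis using exp_diff_pos by simp
qed

end

section \<open>Existence and uniqueness of the equivalent martingale measure\<close>

definition Q :: "nat \<Rightarrow> (nat \<Rightarrow> bool) pmf" where
  "Q n = Pi_pmf {..<n} False (\<lambda>_. bernoulli_pmf (pst n))"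

lemma finite_set_P: "finite (set_pmf (binom_P p n))" and finite_set_Q: "finite (set_pmf (Q n))"
  unfolding binom_P_def Q_def by (auto intro!: finite_subset[OF set_Pi_pmf_subset'] finite_PiE_dflt)

lemma set_Q: "0 < n \<Longrightarrow> set_pmf (Q n) = set_pmf (binom_P p n)"
  using pst_pos pst_less p_pos p_less unfolding Q_def binom_P_def by (simp add: set_Pi_pmf comp_def)

lemma binom_S_Suc: "binom_S p n (Suc k) \<omega> = binom_S p n k \<omega> * exp (if \<omega> k then up n else - dn n)"
  unfolding binom_S_def binom_xi_def
  by (simp add: zeta_eq add_divide_distrib exp_add up_def dn_def)

lemma binom_S_cong: "(\<And>j. j < k \<Longrightarrow> \<omega> j = \<omega>' j) \<Longrightarrow> binom_S p n k \<omega> = binom_S p n k \<omega>'"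
  unfolding binom_S_def binom_xi_def by simp

text \<open>An event of the first \<open>k\<close> coordinates and \<open>binom_S p n k\<close> both
  ignore coordinate \<open>k\<close>, so the growth factor splits off with mean 1.\<close>

lemma binom_EMM_Q:
  assumes n: "0 < n"
  shows "binom_EMM p n (Q n)"
  unfolding binom_EMM_def
proof (intro conjI allI impI)
  fix A
  show "measure_pmf.prob (Q n) A = 0 \<longleftrightarrow> measure_pmf.prob (binom_P p n) A = 0"
    by (simp add: measure_pmf_zero_iff set_Q[OF n])
next
  fix k A assume k: "k < n" and A: "binom_F_event k A"
  let ?F = "\<lambda>\<omega>. indicator A \<omega> * binom_S p n k \<omega> :: real"
  have F: "?F (f(k := y)) = ?F f" for f y
  proof -
    have "f(k := y) \<in> A \<longleftrightarrow> f \<in> A" using A unfolding binom_F_event_def by (metis fun_upd_other less_irrefl)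
    moreover have "binom_S p n k (f(k := y)) = binom_S p n k f" by (rule binom_S_cong) simp
    ultimately show ?thesis by (simp add: indicator_def)
  qed
  have E: "measure_pmf.expectation (Q n) (\<lambda>\<omega>. ?F \<omega> * G (\<omega> k)) =
    measure_pmf.expectation (bernoulli_pmf (pst n)) G *
    measure_pmf.expectation (Pi_pmf ({..<n} - {k}) False (\<lambda>_. bernoulli_pmf (pst n))) ?F" for G :: "bool \<Rightarrow> real"
    unfolding Q_def using k by (intro integral_Pi_pmf_coordinate F) auto
  have "measure_pmf.expectation (bernoulli_pmf (pst n)) (\<lambda>b. exp (if b then up n else - dn n)) = 1"
    using pst_pos[OF n] pst_less[OF n] pst_martingale[OF n] by (simp add: mult.commute)
  then have "measure_pmf.expectation (Q n) (\<lambda>\<omega>. ?F \<omega> * exp (if \<omega> k then up n else - dn n)) =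
      measure_pmf.expectation (Q n) (\<lambda>\<omega>. ?F \<omega> * 1)"
    using E[of "\<lambda>b. exp (if b then up n else - dn n)"] E[of "\<lambda>_. 1"] by simp
  then show "measure_pmf.expectation (Q n) (\<lambda>\<omega>. indicator A \<omega> * binom_S p n (Suc k) \<omega>) =
      measure_pmf.expectation (Q n) (\<lambda>\<omega>. indicator A \<omega> * binom_S p n k \<omega>)"
    by (simp add: binom_S_Suc mult.assoc)
qed

text \<open>The martingale identity on the cylinder of a path prefix is one linear equation for the
  probability of an up-move after it, with solution \<open>pst n\<close>. Induction fixes all
  cylinders of length \<open>n\<close>; equivalence supplies the support, on which such a cylinder
  is a single point.\<close>

lemma binom_EMM_unique:
  assumes n: "0 < n" and R: "binom_EMM p n R"
  shows "R = Q n"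
proof -
  have zero: "measure_pmf.prob R A = 0 \<longleftrightarrow> measure_pmf.prob (binom_P p n) A = 0" for A
    using R by (simp add: binom_EMM_def)
  have set_R: "set_pmf R = set_pmf (binom_P p n)"
  proof -
    have "\<omega> \<in> set_pmf R \<longleftrightarrow> \<omega> \<in> set_pmf (binom_P p n)" for \<omega>
      using zero[of "{\<omega>}"] by (simp add: measure_pmf_zero_iff)
    then show ?thesis by blast
  qed
  define C where "C k \<tau> = {\<omega> :: nat \<Rightarrow> bool. \<forall>j<k. \<omega> j = \<tau> j}" for k \<tau>
  have step: "measure_pmf.prob R (C (Suc k) \<tau>) = pmf (bernoulli_pmf (pst n)) (\<tau> k) * measure_pmf.prob R (C k \<tau>)"
    if k: "k < n" for k \<tau>
  proof -
    let ?A = "C k \<tau>" and ?s = "binom_S p n k \<tau>"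
    let ?u = "{\<omega>\<in>C k \<tau>. \<omega> k}" and ?d = "{\<omega>\<in>C k \<tau>. \<not> \<omega> k}"
    have S: "binom_S p n k \<omega> = ?s" if "\<omega> \<in> ?A" for \<omega>
      using that by (intro binom_S_cong) (simp add: C_def)
    have "binom_F_event k ?A" by (auto simp: binom_F_event_def C_def)
    then have "measure_pmf.expectation R (\<lambda>\<omega>. indicator ?A \<omega> * binom_S p n (Suc k) \<omega>) =
        measure_pmf.expectation R (\<lambda>\<omega>. indicator ?A \<omega> * binom_S p n k \<omega>)"
      using R k unfolding binom_EMM_def by blast
    also have "(\<lambda>\<omega>. indicator ?A \<omega> * binom_S p n (Suc k) \<omega>) =
        (\<lambda>\<omega>. ?s * (exp (up n) * indicator ?u \<omega> + exp (- dn n) * indicator ?d \<omega>))"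
      using S by (auto simp: fun_eq_iff binom_S_Suc indicator_def)
    also have "(\<lambda>\<omega>. indicator ?A \<omega> * binom_S p n k \<omega>) =
        (\<lambda>\<omega>. ?s * (indicator ?u \<omega> + indicator ?d \<omega>))"
      using S by (auto simp: fun_eq_iff indicator_def)
    finally have fin: "measure_pmf.expectation R (\<lambda>\<omega>. ?s * (exp (up n) * indicator ?u \<omega> + exp (- dn n) * indicator ?d \<omega>)) =
        measure_pmf.expectation R (\<lambda>\<omega>. ?s * (indicator ?u \<omega> + indicator ?d \<omega>))" .
    have int: "integrable (measure_pmf R) (\<lambda>\<omega>. indicator B \<omega> :: real)" for B
      by (rule measure_pmf.integrable_const_bound[of _ 1]) auto
    have "?s * (exp (up n) * measure_pmf.prob R ?u + exp (- dn n) * measure_pmf.prob R ?d) =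
        ?s * (measure_pmf.prob R ?u + measure_pmf.prob R ?d)"
      using fin by (simp add: int)
    moreover have "0 < ?s" by (simp add: binom_S_def)
    ultimately have eq: "exp (up n) * measure_pmf.prob R ?u + exp (- dn n) * measure_pmf.prob R ?d =
        measure_pmf.prob R ?u + measure_pmf.prob R ?d"
      by simp
    have A_eq: "measure_pmf.prob R ?A = measure_pmf.prob R ?u + measure_pmf.prob R ?d"
      by (subst measure_pmf.finite_measure_Union[symmetric]) (auto intro!: arg_cong[of _ _ "measure_pmf.prob R"])
    have "(exp (up n) - exp (- dn n)) * measure_pmf.prob R ?u = (1 - exp (- dn n)) * measure_pmf.prob R ?A"
      using eq unfolding A_eq by (simp add: algebra_simps)
    then have u: "measure_pmf.prob R ?u = pst n * measure_pmf.prob R ?A"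
      using exp_diff_pos[OF n] by (simp add: pst_def field_simps)
    then have d: "measure_pmf.prob R ?d = (1 - pst n) * measure_pmf.prob R ?A"
      using A_eq by (simp add: algebra_simps)
    have "C (Suc k) \<tau> = (if \<tau> k then ?u else ?d)"
      by (auto simp: C_def less_Suc_eq)
    then show ?thesis using u d pst_pos[OF n] pst_less[OF n] by simp
  qed
  have cyl: "measure_pmf.prob R (C k \<tau>) = (\<Prod>j<k. pmf (bernoulli_pmf (pst n)) (\<tau> j))" if "k \<le> n" for k \<tau>
    using that
  proof (induction k)
    case 0
    show ?case using measure_pmf.prob_space[of R] by (simp add: C_def)
  next
    case (Suc k)
    then show ?case using step[of k \<tau>] by simp
  qed
  show ?thesis
  proof (rule pmf_eqI)
    fix \<omega>
    show "pmf R \<omega> = pmf (Q n) \<omega>"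
    proof (cases "\<forall>j. j \<notin> {..<n} \<longrightarrow> \<omega> j = False")
      case True
      \<comment> \<open>Coordinates from \<open>n\<close> on carry the default value
        \<open>False\<close> under \<open>binom_P\<close>, and \<open>R\<close> inherits this
        through its support.\<close>
      have sub: "\<omega>' j = False" if "\<omega>' \<in> set_pmf R" "j \<ge> n" for \<omega>' j
        using that set_Pi_pmf_subset[of "{..<n}" False] unfolding set_R binom_P_def by fastforce
      have "C n \<omega> \<inter> set_pmf R = {\<omega>} \<inter> set_pmf R"
      proof (intro equalityI subsetI)
        fix \<omega>' assume w: "\<omega>' \<in> C n \<omega> \<inter> set_pmf R"
        have "\<omega>' j = \<omega> j" for j
          using w sub[of \<omega>' j] True by (cases "j < n") (auto simp: C_def)
        then show "\<omega>' \<in> {\<omega>} \<inter> set_pmf R" using w by auto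
      qed (auto simp: C_def)
      then have "measure_pmf.prob R (C n \<omega>) = measure_pmf.prob R {\<omega>}"
        by (metis measure_Int_set_pmf)
      then have "pmf R \<omega> = (\<Prod>j<n. pmf (bernoulli_pmf (pst n)) (\<omega> j))"
        using cyl[of n \<omega>] by (simp add: measure_pmf_single)
      also have "\<dots> = pmf (Q n) \<omega>" unfolding Q_def using True by (subst pmf_Pi') auto
      finally show ?thesis .
    next
      case False
      then have "pmf (Q n) \<omega> = 0" unfolding Q_def by (intro pmf_Pi_outside) auto
      then have "\<omega> \<notin> set_pmf (Q n)" by (simp add: set_pmf_iff)
      then have "\<omega> \<notin> set_pmf R" by (simp only: set_R set_Q[OF n] not_False_eq_True)
      then show ?thesis using \<open>pmf (Q n) \<omega> = 0\<close> by (simp add: set_pmf_iff)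
    qed
  qed
qed

lemma binom_Pstar_eq: "0 < n \<Longrightarrow> binom_Pstar p n = Q n"
  unfolding binom_Pstar_def by (rule the_equality) (auto intro: binom_EMM_Q binom_EMM_unique)

section \<open>The likelihood ratio and its exponential form\<close>

definition lr :: "nat \<Rightarrow> bool \<Rightarrow> real" where
  "lr n b = (if b then pst n / p else (1 - pst n) / (1 - p))"

definition dens :: "nat \<Rightarrow> (nat \<Rightarrow> bool) \<Rightarrow> real" where
  "dens n \<omega> = (\<Prod>j<n. lr n (\<omega> j))"

lemma lr_pos: "0 < n \<Longrightarrow> 0 < lr n b"
  using pst_pos pst_less p_pos p_less by (simp add: lr_def)

lemma dens_pos: "0 < n \<Longrightarrow> 0 < dens n \<omega>"
  unfolding dens_def by (intro prod_pos) (simp add: lr_pos)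

lemma expectation_Pstar:
  assumes n: "0 < n"
  shows "measure_pmf.expectation (binom_Pstar p n) X = measure_pmf.expectation (binom_P p n) (\<lambda>\<omega>. dens n \<omega> * X \<omega>)"
proof -
  have "pmf (Q n) \<omega> = dens n \<omega> * pmf (binom_P p n) \<omega>" for \<omega>
  proof -
    have "pmf (bernoulli_pmf (pst n)) b = lr n b * pmf (bernoulli_pmf p) b" for b
      using pst_pos[OF n] pst_less[OF n] p_pos p_less by (cases b) (auto simp: lr_def)
    then show ?thesis
      unfolding Q_def binom_P_def dens_def by (auto simp: pmf_Pi prod.distrib)
  qed
  then show ?thesis
    unfolding binom_Pstar_eq[OF n] using finite_set_P[of n] set_Q[OF n]
    by (subst (1 2) integral_measure_pmf_real[of "set_pmf (binom_P p n)"]) (auto intro!: sum.cong simp: mult_ac)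
qed

text \<open>The coefficients for which \<open>ln (lr n b) = - an n / sqrt n * binom_zeta p b - bn n / n\<close>.\<close>

definition an :: "nat \<Rightarrow> real" where
  "an n = (ln (lr n False) - ln (lr n True)) * sqrt (p * (1 - p)) * sqrt (real n)"
definition bn :: "nat \<Rightarrow> real" where
  "bn n = - real n * (p * ln (lr n True) + (1 - p) * ln (lr n False))"

text \<open>Any function on two points is affine in \<open>binom_zeta\<close>, in particular
  \<open>ln (lr n b)\<close>. Its slope is a difference quotient and its constant term is the mean
  under \<open>p\<close>, as \<open>binom_zeta\<close> is centred.\<close>

lemma dens_eq:
  assumes n: "0 < n"
  shows "dens n \<omega> = exp (- an n * binom_xi p n n \<omega> - bn n)"
proof -
  have "ln (lr n b) = - (an n / sqrt n) * binom_zeta p b - bn n / n" for b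
  proof -
    define r where "r = sqrt (p * (1 - p))"
    have r: "r > 0" using sd_pos by (simp add: r_def)
    have e1: "an n / sqrt n = (ln (lr n False) - ln (lr n True)) * r" using n by (simp add: an_def r_def)
    have e2: "bn n / n = - (p * ln (lr n True) + (1 - p) * ln (lr n False))" using n by (simp add: bn_def)
    have e3: "(if b then 1 - p else - p) = binom_zeta p b * r"
      unfolding binom_zeta_def r_def[symmetric] using r by simp
    have "- (an n / sqrt n) * binom_zeta p b - bn n / n =
      - (ln (lr n False) - ln (lr n True)) * (if b then 1 - p else - p) + (p * ln (lr n True) + (1 - p) * ln (lr n False))"
      unfolding e1 e2 e3 by (simp add: algebra_simps)
    also have "\<dots> = ln (lr n b)" by (cases b) (simp_all add: algebra_simps)
    finally show ?thesis ..
  qed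
  then have "(\<Sum>j<n. ln (lr n (\<omega> j))) = (\<Sum>j<n. - (an n / sqrt n) * binom_zeta p (\<omega> j) - bn n / n)"
    by simp
  also have "\<dots> = - (an n / sqrt n) * (\<Sum>j<n. binom_zeta p (\<omega> j)) - bn n"
    using n by (simp add: sum_subtractf sum_distrib_left sum_negf)
  also have "\<dots> = - an n * binom_xi p n n \<omega> - bn n" by (simp add: binom_xi_def)
  finally have "exp (\<Sum>j<n. ln (lr n (\<omega> j))) = exp (- an n * binom_xi p n n \<omega> - bn n)" by simp
  moreover have "exp (\<Sum>j<n. ln (lr n (\<omega> j))) = dens n \<omega>"
    using lr_pos[OF n] by (simp add: exp_sum dens_def)
  ultimately show ?thesis by simp
qed

text \<open>Writing \<open>p = dn n / (up n + dn n)\<close> pairs each exponential difference with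
  its exponent, so that the \<open>lsinhc\<close> formulas apply to numerator and
  denominator.\<close>

lemma ln_lr_True:
  assumes n: "0 < n"
  shows "ln (lr n True) = - up n / 2 + lsinhc (dn n / 2) - lsinhc ((up n + dn n) / 2)"
proof -
  note pos = up_pos[OF n] dn_pos[OF n] exp_diff_pos[OF n]
  have "dn n = p * (up n + dn n)"
    using zd_eq unfolding up_def dn_def by (metis add_divide_distrib times_divide_eq_right)
  then have p_eq: "p = dn n / (up n + dn n)" using pos by (simp add: field_simps)
  have "lr n True = ((1 - exp (- dn n)) / dn n) / ((exp (up n) - exp (- dn n)) / (up n + dn n))"
    unfolding lr_def pst_def by (subst p_eq) (simp add: field_simps)
  also have "ln \<dots> = ln ((1 - exp (- dn n)) / dn n) - ln ((exp (up n) - exp (- dn n)) / (up n + dn n))"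
    using pos by (subst ln_div) auto
  also have "\<dots> = (- dn n / 2 + lsinhc (dn n / 2)) - ((up n - dn n) / 2 + lsinhc ((up n + dn n) / 2))"
    using ln_one_minus_exp_div[of "dn n"] ln_exp_diff_div[of "up n" "dn n"] pos by simp
  also have "\<dots> = - up n / 2 + lsinhc (dn n / 2) - lsinhc ((up n + dn n) / 2)"
    by (simp add: field_simps)
  finally show ?thesis .
qed

lemma ln_lr_False:
  assumes n: "0 < n"
  shows "ln (lr n False) = dn n / 2 + lsinhc (up n / 2) - lsinhc ((up n + dn n) / 2)"
proof -
  note pos = up_pos[OF n] dn_pos[OF n] exp_diff_pos[OF n]
  have "up n = (1 - p) * (up n + dn n)"
    using zu_eq unfolding up_def dn_def by (metis add_divide_distrib times_divide_eq_right)
  then have p_eq: "1 - p = up n / (up n + dn n)" using pos by (simp add: field_simps)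
  have "lr n False = (1 - pst n) / (1 - p)" by (simp add: lr_def)
  also have "\<dots> = ((exp (up n) - 1) / up n) / ((exp (up n) - exp (- dn n)) / (up n + dn n))"
    unfolding one_minus_pst[OF n] p_eq by (simp add: field_simps)
  also have "ln \<dots> = ln ((exp (up n) - 1) / up n) - ln ((exp (up n) - exp (- dn n)) / (up n + dn n))"
    using pos by (subst ln_div) auto
  also have "\<dots> = (up n / 2 + lsinhc (up n / 2)) - ((up n - dn n) / 2 + lsinhc ((up n + dn n) / 2))"
    using ln_exp_minus_one_div[of "up n"] ln_exp_diff_div[of "up n" "dn n"] pos by simp
  also have "\<dots> = dn n / 2 + lsinhc (up n / 2) - lsinhc ((up n + dn n) / 2)"
    by (simp add: field_simps)
  finally show ?thesis .
qed

text \<open>The linear parts give exactly 1/2 since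
  \<open>(zu + zd) * sqrt (p * (1 - p)) = 1\<close>. The common term
  \<open>lsinhc ((up n + dn n) / 2)\<close> cancels.\<close>

lemma an_eq:
  assumes n: "0 < n"
  shows "an n = 1 / 2 + (lsinhc (up n / 2) - lsinhc (dn n / 2)) * sqrt (p * (1 - p)) * sqrt (real n)"
proof -
  have "ln (lr n False) - ln (lr n True) = (up n + dn n) / 2 + (lsinhc (up n / 2) - lsinhc (dn n / 2))"
    unfolding ln_lr_True[OF n] ln_lr_False[OF n] by (simp add: field_simps)
  moreover have "(up n + dn n) * sqrt (real n) = zu + zd"
    using n by (simp add: up_def dn_def field_simps)
  then have "(up n + dn n) / 2 * sqrt (p * (1 - p)) * sqrt (real n) = (zu + zd) * sqrt (p * (1 - p)) / 2"
    by (simp add: mult_ac)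
  ultimately show ?thesis unfolding an_def zu_zd by (simp add: distrib_right)
qed

lemma an_le: "0 < n \<Longrightarrow> an n \<le> 1 / 2"
proof -
  assume n: "0 < n"
  have "lsinhc (up n / 2) - lsinhc (dn n / 2) \<le> 0"
    using lsinhc_mono[of "up n / 2" "dn n / 2"] up_pos[OF n] up_le_dn[OF n] by simp
  then have "(lsinhc (up n / 2) - lsinhc (dn n / 2)) * (sqrt (p * (1 - p)) * sqrt (real n)) \<le> 0"
    using sd_pos by (intro mult_nonpos_nonneg) auto
  then show ?thesis unfolding an_eq[OF n] mult.assoc by linarith
qed

lemma lsinhc_step_limit:
  assumes "0 < c"
  shows "(\<lambda>n. lsinhc (c / sqrt (real n) / 2) * real n) \<longlonglongrightarrow> c\<^sup>2 / 24"
  using lsinhc_scaled_limit[of "c / 2"] assms by (simp add: power_divide mult.commute)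

text \<open>The \<open>lsinhc\<close> terms are of order \<open>1/n\<close> and are multiplied only
  by \<open>sqrt n\<close>.\<close>

lemma an_limit: "an \<longlonglongrightarrow> 1 / 2"
proof -
  have 1: "(\<lambda>n. 1 / sqrt (real n)) \<longlonglongrightarrow> 0" by real_asymp
  have "(\<lambda>n. 1 / 2 + (lsinhc (zu / sqrt (real n) / 2) * real n - lsinhc (zd / sqrt (real n) / 2) * real n)
      * sqrt (p * (1 - p)) * (1 / sqrt (real n))) \<longlonglongrightarrow> 1 / 2 + (zu\<^sup>2 / 24 - zd\<^sup>2 / 24) * sqrt (p * (1 - p)) * 0"
    by (intro tendsto_intros lsinhc_step_limit zu_pos zd_pos 1)
  then have "(\<lambda>n. 1 / 2 + (lsinhc (zu / sqrt (real n) / 2) * real n - lsinhc (zd / sqrt (real n) / 2) * real n)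
      * sqrt (p * (1 - p)) * (1 / sqrt (real n))) \<longlonglongrightarrow> 1 / 2" by simp
  then show ?thesis
  proof (rule Lim_transform_eventually)
    show "eventually (\<lambda>n. 1 / 2 + (lsinhc (zu / sqrt (real n) / 2) * real n - lsinhc (zd / sqrt (real n) / 2) * real n)
      * sqrt (p * (1 - p)) * (1 / sqrt (real n)) = an n) sequentially"
      using eventually_gt_at_top[of 0]
    proof eventually_elim
      case (elim n)
      have "(x * real n - y * real n) * r * (1 / sqrt (real n)) = (x - y) * r * sqrt (real n)" for x y r
      proof -
        have "(x * real n - y * real n) * r * (1 / sqrt (real n)) = (x - y) * r * (real n / sqrt (real n))"
          by (simp add: algebra_simps)
        then show ?thesis by (simp only: real_div_sqrt[OF of_nat_0_le_iff])
      qed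
      then show ?case unfolding an_eq[OF elim] up_def dn_def by (simp only:)
    qed
  qed
qed

text \<open>The linear parts cancel because \<open>p * up n = (1 - p) * dn n\<close>, that is,
  because \<open>binom_zeta\<close> has mean zero.\<close>

lemma bn_eq:
  assumes n: "0 < n"
  shows "bn n = lsinhc ((up n + dn n) / 2) * n - p * (lsinhc (dn n / 2) * n) - (1 - p) * (lsinhc (up n / 2) * n)"
proof -
  have "p * zu = (1 - p) * zd" by (simp add: zu_def zd_def)
  then have "p * up n = (1 - p) * dn n" by (simp add: up_def dn_def)
  then have eq: "p * ln (lr n True) + (1 - p) * ln (lr n False) =
      p * lsinhc (dn n / 2) + (1 - p) * lsinhc (up n / 2) - lsinhc ((up n + dn n) / 2)"
    unfolding ln_lr_True[OF n] ln_lr_False[OF n] by (simp add: algebra_simps)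
  show ?thesis unfolding bn_def eq by (simp add: algebra_simps)
qed

lemma bn_limit: "bn \<longlonglongrightarrow> 1 / 8"
proof -
  have "(\<lambda>n. lsinhc ((zu + zd) / sqrt (real n) / 2) * n - p * (lsinhc (zd / sqrt (real n) / 2) * n)
      - (1 - p) * (lsinhc (zu / sqrt (real n) / 2) * n))
      \<longlonglongrightarrow> (zu + zd)\<^sup>2 / 24 - p * (zd\<^sup>2 / 24) - (1 - p) * (zu\<^sup>2 / 24)"
    using zu_pos zd_pos by (intro tendsto_intros lsinhc_step_limit) auto
  \<comment> \<open>With \<open>s = zu + zd\<close> the sum is \<open>s\<^sup>2 / 24\<close> times
    \<open>1 - p^3 - (1 - p)^3 = 3 * p * (1 - p)\<close>, and
    \<open>s\<^sup>2 * (p * (1 - p)) = 1\<close>.\<close>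
  also have "(zu + zd)\<^sup>2 / 24 - p * (zd\<^sup>2 / 24) - (1 - p) * (zu\<^sup>2 / 24) = 1 / 8"
  proof -
    define s where "s = zu + zd"
    have s: "s\<^sup>2 * (p * (1 - p)) = 1" using zu_zd_sq by (simp add: s_def)
    have zu2: "zu\<^sup>2 = (1 - p)\<^sup>2 * s\<^sup>2" and zd2: "zd\<^sup>2 = p\<^sup>2 * s\<^sup>2"
      using zu_eq zd_eq by (simp_all add: s_def power_mult_distrib[symmetric])
    have eq: "s\<^sup>2 / 24 - p * (zd\<^sup>2 / 24) - (1 - p) * (zu\<^sup>2 / 24) = 3 * (s\<^sup>2 * (p * (1 - p))) / 24"
      unfolding zu2 zd2 by (simp add: power2_eq_square field_simps)
    show ?thesis unfolding s_def[symmetric] eq s by simp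
  qed
  finally show ?thesis
  proof (rule Lim_transform_eventually)
    show "eventually (\<lambda>n. lsinhc ((zu + zd) / sqrt (real n) / 2) * n - p * (lsinhc (zd / sqrt (real n) / 2) * n)
      - (1 - p) * (lsinhc (zu / sqrt (real n) / 2) * n) = bn n) sequentially"
      using eventually_gt_at_top[of 0]
    proof eventually_elim
      case (elim n)
      show ?case unfolding bn_eq[OF elim] by (simp add: up_def dn_def add_divide_distrib)
    qed
  qed
qed

section \<open>The law of the terminal log-price: Chernoff bound and central limit theorem\<close>

definition law :: "nat \<Rightarrow> real measure" where
  "law n = distr (binom_P p n) borel (binom_xi p n n)"

lemma real_distribution_law: "real_distribution (law n)"
  unfolding law_def by (intro prob_space.real_distribution_distr measure_pmf.prob_space_axioms) auto

lemma integral_law: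
  "f \<in> borel_measurable borel \<Longrightarrow> (\<integral>s. f s \<partial>law n) = measure_pmf.expectation (binom_P p n) (\<lambda>\<omega>. f (binom_xi p n n \<omega>))"
  for f :: "real \<Rightarrow> real"
  unfolding law_def by (intro integral_distr) auto

lemma integrable_P: "integrable (measure_pmf (binom_P p n)) f" for f :: "_ \<Rightarrow> real"
  by (rule integrable_measure_pmf_finite[OF finite_set_P])

lemma integrable_law:
  "f \<in> borel_measurable borel \<Longrightarrow> integrable (law n) f" for f :: "real \<Rightarrow> real"
  unfolding law_def by (subst integrable_distr_eq) (auto intro: integrable_P)

lemma chernoff:
  assumes n: "0 < n" and s: "0 \<le> s"
  shows "measure (law n) {s..} \<le> exp (- s\<^sup>2 / 2)"
proof -
  let ?P = "measure_pmf (binom_P p n)"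
  define r where "r = sqrt (p * (1 - p))"
  have r: "r > 0" "r\<^sup>2 = p * (1 - p)" using sd_pos p_pos p_less by (simp_all add: r_def)
  \<comment> \<open>The exponential moment is taken at \<open>s\<close> itself, the optimal choice
    for a Gaussian; dividing by \<open>r\<close> passes from \<open>binom_zeta\<close> to the
    centred Bernoulli variable of the moment bound.\<close>
  define t where "t = s / sqrt n / r"
  have t: "0 \<le> t" using s r by (simp add: t_def)
  have E: "measure_pmf.expectation (binom_P p n) (\<lambda>\<omega>. exp (s * binom_xi p n n \<omega>)) \<le> exp (s\<^sup>2 / 2)"
  proof -
    have "exp (s * binom_xi p n n \<omega>) = (\<Prod>j<n. exp (s / sqrt n * binom_zeta p (\<omega> j)))" for \<omega>
      by (simp add: binom_xi_def sum_distrib_left sum_divide_distrib flip: exp_sum)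
    then have "measure_pmf.expectation (binom_P p n) (\<lambda>\<omega>. exp (s * binom_xi p n n \<omega>)) =
        measure_pmf.expectation (Pi_pmf {..<n} False (\<lambda>_. bernoulli_pmf p)) (\<lambda>\<omega>. \<Prod>j<n. exp (s / sqrt n * binom_zeta p (\<omega> j)))"
      unfolding binom_P_def by (simp only:)
    also have "\<dots> = (\<Prod>j<n. measure_pmf.expectation (bernoulli_pmf p) (\<lambda>b. exp (s / sqrt n * binom_zeta p b)))"
      by (rule expectation_prod_Pi_pmf) (auto intro!: integrable_measure_pmf_finite)
    also have "measure_pmf.expectation (bernoulli_pmf p) (\<lambda>b. exp (s / sqrt n * binom_zeta p b)) =
        p * exp ((1 - p) * t) + (1 - p) * exp (- p * t)"
      using p_pos p_less by (simp add: binom_zeta_def t_def r_def mult_ac)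
    also have "(\<Prod>j<n. p * exp ((1 - p) * t) + (1 - p) * exp (- p * t)) \<le> (\<Prod>j<n. exp (p * (1 - p) * t\<^sup>2 / 2))"
      using bernoulli_mgf_le[OF p_ge p_less t] p_pos p_less by (intro prod_mono) (auto intro!: add_nonneg_nonneg)
    also have "\<dots> = exp (s\<^sup>2 / 2)"
    proof -
      have "p * (1 - p) * t\<^sup>2 = s\<^sup>2 / n"
        unfolding t_def r(2)[symmetric] using r(1) by (simp add: power_divide power_mult_distrib)
      then show ?thesis using n by (simp flip: exp_of_nat_mult)
    qed
    finally show ?thesis .
  qed
  have "measure (law n) {s..} = measure_pmf.prob (binom_P p n) {\<omega>. s \<le> binom_xi p n n \<omega>}"
    unfolding law_def by (subst measure_distr) (auto intro!: arg_cong[of _ _ "measure_pmf.prob _"])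
  also have "\<dots> \<le> measure_pmf.prob (binom_P p n) {\<omega>\<in>space ?P. exp (s\<^sup>2) \<le> exp (s * binom_xi p n n \<omega>)}"
    using s by (intro measure_pmf.finite_measure_mono) (auto simp: power2_eq_square mult_left_mono)
  also have "\<dots> \<le> measure_pmf.expectation (binom_P p n) (\<lambda>\<omega>. exp (s * binom_xi p n n \<omega>)) / exp (s\<^sup>2)"
    by (rule integral_Markov_inequality_measure[where A="{}"]) (auto intro: integrable_P)
  also have "\<dots> \<le> exp (s\<^sup>2 / 2) / exp (s\<^sup>2)" using E by (intro divide_right_mono) auto
  also have "\<dots> = exp (- s\<^sup>2 / 2)" by (simp flip: exp_diff)
  finally show ?thesis .
qed

text \<open>The measures \<open>binom_P p n\<close> live on different models, while the central
  limit theorem wants one i.i.d. sequence. That sequence is built on an infinite product; both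
  spaces project to the same finite product of the first \<open>n\<close> coordinates, so the laws
  agree.\<close>

lemma weak_conv_law: "weak_conv_m law std_normal_distribution"
proof -
  let ?B = "measure_pmf (bernoulli_pmf p)"
  define \<Omega> where "\<Omega> = PiM (UNIV :: nat set) (\<lambda>_. ?B)"
  interpret prod: product_prob_space "\<lambda>_. ?B" "UNIV :: nat set"
    by (intro product_prob_spaceI measure_pmf.prob_space_axioms)
  interpret \<Omega>: prob_space \<Omega> unfolding \<Omega>_def by (intro prob_space_PiM measure_pmf.prob_space_axioms)
  define X where "X i \<omega> = binom_zeta p (\<omega> i)" for i :: nat and \<omega> :: "nat \<Rightarrow> bool"
  have comp [measurable]: "(\<lambda>\<omega>. \<omega> i) \<in> measurable \<Omega> ?B" for i
    unfolding \<Omega>_def by (rule measurable_component_singleton) simp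
  have comp' [measurable]: "(\<lambda>\<omega>. \<omega> i) \<in> measurable \<Omega> (count_space UNIV)" for i
    using comp[of i] by simp
  have comp_distr: "distr \<Omega> ?B (\<lambda>\<omega>. \<omega> i) = ?B" for i
    unfolding \<Omega>_def by (rule distr_PiM_component) (auto intro: measure_pmf.prob_space_axioms)
  have zeta [measurable]: "binom_zeta p \<in> measurable ?B borel" by simp
  have X_meas [measurable]: "X i \<in> borel_measurable \<Omega>" for i
    unfolding X_def by (rule measurable_compose[OF comp zeta])
  have "\<Omega>.indep_vars (\<lambda>_. ?B) (\<lambda>i \<omega>. \<omega> i) UNIV"
  proof (subst \<Omega>.indep_vars_iff_distr_eq_PiM)
    show "distr \<Omega> (Pi\<^sub>M UNIV (\<lambda>i. ?B)) (\<lambda>x. \<lambda>i\<in>UNIV. x i) = Pi\<^sub>M UNIV (\<lambda>i. distr \<Omega> ?B (\<lambda>\<omega>. \<omega> i))"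
      unfolding comp_distr by (simp add: \<Omega>_def[symmetric] restrict_UNIV distr_id)
  qed (rule UNIV_not_empty | rule comp)+
  then have indep: "\<Omega>.indep_vars (\<lambda>_. borel) X UNIV"
    unfolding X_def by (rule \<Omega>.indep_vars_compose2) auto
  have distr_X: "distr \<Omega> borel (X i) = distr ?B borel (binom_zeta p)" for i
  proof -
    have "distr \<Omega> borel (X i) = distr (distr \<Omega> ?B (\<lambda>\<omega>. \<omega> i)) borel (binom_zeta p)"
      by (subst distr_distr) (auto simp: comp_def X_def[abs_def])
    then show ?thesis by (simp add: comp_distr)
  qed
  have E: "\<Omega>.expectation (\<lambda>\<omega>. f (X i \<omega>)) = measure_pmf.expectation (bernoulli_pmf p) (\<lambda>b. f (binom_zeta p b))"
    if "f \<in> borel_measurable borel" for f :: "real \<Rightarrow> real" and i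
  proof -
    have "\<Omega>.expectation (\<lambda>\<omega>. f (X i \<omega>)) = (\<integral>s. f s \<partial>distr \<Omega> borel (X i))"
      using that by (subst integral_distr) auto
    also have "\<dots> = measure_pmf.expectation (bernoulli_pmf p) (\<lambda>b. f (binom_zeta p b))"
      unfolding distr_X using that by (subst integral_distr) auto
    finally show ?thesis .
  qed
  have mean: "\<Omega>.expectation (X i) = 0" for i
    using E[of "\<lambda>s. s" i] p_pos p_less by (simp add: zeta_eq zu_def zd_def)
  have var: "\<Omega>.expectation (\<lambda>\<omega>. (X i \<omega>)\<^sup>2) = 1" for i
  proof -
    have "\<Omega>.expectation (\<lambda>\<omega>. (X i \<omega>)\<^sup>2) = p * zu\<^sup>2 + (1 - p) * zd\<^sup>2"
      using E[of "\<lambda>s. s\<^sup>2" i] p_pos p_less by (simp add: zeta_eq)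
    also have "\<dots> = (zu + zd)\<^sup>2 * (p * (1 - p))"
    proof -
      define s where "s = zu + zd"
      have zu2: "zu\<^sup>2 = (1 - p)\<^sup>2 * s\<^sup>2" and zd2: "zd\<^sup>2 = p\<^sup>2 * s\<^sup>2"
        using zu_eq zd_eq by (simp_all add: s_def power_mult_distrib[symmetric])
      show ?thesis unfolding zu2 zd2 s_def[symmetric] by (simp add: power2_eq_square algebra_simps)
    qed
    finally show ?thesis by (simp add: zu_zd_sq)
  qed
  have bound: "\<bar>X i \<omega>\<bar> \<le> zd" for i \<omega> using zu_pos zu_le_zd by (simp add: X_def zeta_eq)
  have "weak_conv_m (\<lambda>n. distr \<Omega> borel (\<lambda>\<omega>. (\<Sum>i<n. X i \<omega>) / sqrt (real n * 1\<^sup>2))) std_normal_distribution"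
  proof (rule \<Omega>.central_limit_theorem_zero_mean[OF indep mean])
    show "integrable \<Omega> (\<lambda>\<omega>. (X i \<omega>)\<^sup>2)" for i
      using bound[of i] by (intro \<Omega>.integrable_const_bound[of _ "zd\<^sup>2"]) (auto simp: abs_le_square_iff[symmetric] zd_pos less_imp_le)
    show "\<Omega>.variance (X i) = 1\<^sup>2" for i using mean[of i] var[of i] by simp
  qed (auto simp: distr_X)
  moreover have "law n = distr \<Omega> borel (\<lambda>\<omega>. (\<Sum>i<n. X i \<omega>) / sqrt (real n * 1\<^sup>2))" for n
  proof (cases "n = 0")
    \<comment> \<open>For \<open>n = 0\<close> division by \<open>sqrt 0\<close> gives 0, and both
      laws are the point mass at 0.\<close>
    case True
    have "distr N borel (\<lambda>\<omega>. 0 :: real) = return borel 0" if "prob_space N" for N :: "(nat \<Rightarrow> bool) measure"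
      using that by (rule prob_space.distr_const) simp
    then show ?thesis
      using True measure_pmf.prob_space_axioms \<Omega>.prob_space_axioms
      by (simp add: law_def binom_xi_def[abs_def])
  next
    case False
    let ?R = "PiM {..<n} (\<lambda>_. ?B)"
    let ?f = "\<lambda>\<tau>. (\<Sum>j<n. binom_zeta p (\<tau> j)) / sqrt n"
    have R1: "distr \<Omega> ?R (\<lambda>x. restrict x {..<n}) = ?R"
      unfolding \<Omega>_def by (rule prod.distr_PiM_restrict_finite) auto
    have indep_P: "prob_space.indep_vars (measure_pmf (binom_P p n)) (\<lambda>_. count_space UNIV) (\<lambda>i f. f i) {..<n}"
      unfolding binom_P_def by (rule indep_vars_Pi_pmf) simp
    have R2: "distr (measure_pmf (binom_P p n)) ?R (\<lambda>x. restrict x {..<n}) = ?R"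
    proof -
      have "distr (measure_pmf (binom_P p n)) (PiM {..<n} (\<lambda>_. count_space UNIV)) (\<lambda>x. \<lambda>i\<in>{..<n}. x i) =
          (\<Pi>\<^sub>M i\<in>{..<n}. distr (measure_pmf (binom_P p n)) (count_space UNIV) (\<lambda>f. f i))"
        using False
        by (intro prob_space.indep_vars_iff_distr_eq_PiM'[OF measure_pmf.prob_space_axioms, THEN iffD1, OF _ _ indep_P]) auto
      also have "\<dots> = PiM {..<n} (\<lambda>_. ?B)"
      proof (rule PiM_cong[OF refl])
        fix i assume "i \<in> {..<n}"
        then have "map_pmf (\<lambda>f. f i) (binom_P p n) = bernoulli_pmf p"
          unfolding binom_P_def by (subst Pi_pmf_component) auto
        then show "distr (measure_pmf (binom_P p n)) (count_space UNIV) (\<lambda>f. f i) = ?B"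
          by (metis map_pmf_rep_eq)
      qed
      finally have *: "distr (measure_pmf (binom_P p n)) (PiM {..<n} (\<lambda>_. count_space UNIV)) (\<lambda>x. \<lambda>i\<in>{..<n}. x i) = ?R" .
      have "distr (measure_pmf (binom_P p n)) ?R (\<lambda>x. \<lambda>i\<in>{..<n}. x i) =
          distr (measure_pmf (binom_P p n)) (PiM {..<n} (\<lambda>_. count_space UNIV)) (\<lambda>x. \<lambda>i\<in>{..<n}. x i)"
        by (intro distr_cong sets_PiM_cong refl) auto
      then show ?thesis using * by simp
    qed
    have "(\<lambda>\<tau>. binom_zeta p (\<tau> j)) \<in> borel_measurable ?R" if "j < n" for j
    proof (rule measurable_compose[OF _ zeta])
      show "(\<lambda>\<tau>. \<tau> j) \<in> measurable ?R ?B"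
        by (rule measurable_component_singleton) (use that in simp)
    qed
    then have f [measurable]: "?f \<in> borel_measurable ?R"
      by (intro borel_measurable_divide borel_measurable_sum borel_measurable_const) auto
    have "law n = distr (distr (measure_pmf (binom_P p n)) ?R (\<lambda>x. restrict x {..<n})) borel ?f"
      unfolding law_def
      by (subst distr_distr) (auto simp: comp_def binom_xi_def[abs_def] space_PiM)
    also have "\<dots> = distr (distr \<Omega> ?R (\<lambda>x. restrict x {..<n})) borel ?f"
      by (simp only: R1 R2)
    also have "\<dots> = distr \<Omega> borel (\<lambda>\<omega>. (\<Sum>i<n. X i \<omega>) / sqrt (real n * 1\<^sup>2))"
    proof (subst distr_distr)
      show "(\<lambda>x. restrict x {..<n}) \<in> measurable \<Omega> ?R"
        unfolding \<Omega>_def by (rule measurable_restrict_subset) auto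
    qed (auto simp: comp_def X_def)
    finally show ?thesis .
  qed
  then have "law = (\<lambda>n. distr \<Omega> borel (\<lambda>\<omega>. (\<Sum>i<n. X i \<omega>) / sqrt (real n * 1\<^sup>2)))" by auto
  ultimately show ?thesis by simp
qed

end

section \<open>Convergence of the value functions\<close>

context utility
begin

lemma std_normal_utility_density: "utility_density U std_normal_distribution bs_density"
proof -
  interpret real_distribution std_normal_distribution by (rule real_distribution_std_normal)
  show ?thesis
    by unfold_locales (auto simp: bs_density_def[abs_def, symmetric] integrable_bs_density integral_bs_density, simp add: bs_density_def)
qed

text \<open>If no \<open>y\<close> makes the conjugate integrable, the infimum is over the empty set and equals \<open>\<infinity>\<close>.\<close>

definition dual_bound :: "real \<Rightarrow> ereal" where
  "dual_bound x = (INF y\<in>{y. 0 < y \<and> integrable std_normal_distribution (\<lambda>s. V (y * bs_density s))}.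
     ereal ((\<integral>s. V (y * bs_density s) \<partial>std_normal_distribution) + x * y))"

lemma dual_bound_less:
  assumes "dual_bound x < ereal c"
  obtains y where "0 < y" "integrable std_normal_distribution (\<lambda>s. V (y * bs_density s))"
    "(\<integral>s. V (y * bs_density s) \<partial>std_normal_distribution) + x * y < c"
  using assms unfolding dual_bound_def by (auto simp: INF_less_iff)

text \<open>A real \<open>c'\<close> strictly between \<open>c\<close> and the dual value serves as
  lower bound of all dual values; this covers an infinite \<open>dual_bound\<close> as well.\<close>

lemma near_optimal:
  assumes x: "0 < x" and c: "ereal c < dual_bound x"
  obtains d y where "0 < d" "0 < y"
    "(\<integral>s. bs_density s * I (max (y * bs_density s) d) \<partial>std_normal_distribution) < x"
    "c < (\<integral>s. U (I (max (y * bs_density s) d)) \<partial>std_normal_distribution)"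
proof -
  interpret utility_density U std_normal_distribution bs_density by (rule std_normal_utility_density)
  obtain c' where c': "ereal c < ereal c'" "ereal c' < dual_bound x"
    using ereal_dense2[OF c] by blast
  have "\<exists>d>0. \<exists>y>0. expectation (\<lambda>s. bs_density s * J d y s) < x \<and> c < expectation (\<lambda>s. U (J d y s))"
  proof (rule ex_near_optimal[OF x])
    fix y :: real assume "0 < y" "integrable std_normal_distribution (\<lambda>s. V (y * bs_density s))"
    then have "dual_bound x \<le> ereal (expectation (\<lambda>s. V (y * bs_density s)) + x * y)"
      unfolding dual_bound_def by (intro INF_lower) auto
    then have "ereal c' \<le> ereal (expectation (\<lambda>s. V (y * bs_density s)) + x * y)"
      using c'(2) by (meson less_imp_le order_trans)
    then show "c' \<le> expectation (\<lambda>s. V (y * bs_density s)) + x * y" by simp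
  qed (use c' in simp)
  then show ?thesis using that by (auto simp: J_def)
qed

text \<open>The conjugate is split as \<open>V (y' * z) = V (y' * max z k) + g k z\<close>. The
  first part is bounded above and falls to the Fatou argument for its negative; the excess near 0 is
  controlled by the tail domination.\<close>

lemma expectation_V_limsup:
  fixes \<mu> :: "nat \<Rightarrow> real measure"
  assumes \<mu>: "\<And>n. real_distribution (\<mu> n)" "weak_conv_m \<mu> std_normal_distribution"
    and a: "a \<longlonglongrightarrow> 1 / 2" "\<And>n. a n \<le> 1 / 2" and b: "b \<longlonglongrightarrow> 1 / 8"
    and chernoff: "\<And>n s. 0 \<le> s \<Longrightarrow> measure (\<mu> n) {s..} \<le> exp (- s\<^sup>2 / 2)"
    and D_mean: "\<And>n. (\<integral>s. exp (- a n * s - b n) \<partial>\<mu> n) = 1"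
    and int: "\<And>n f. f \<in> borel_measurable borel \<Longrightarrow> integrable (\<mu> n) (f :: real \<Rightarrow> real)"
    and y: "0 < y" "y < y'" and V_int: "integrable std_normal_distribution (\<lambda>s. V (y * bs_density s))"
    and c: "(\<integral>s. V (y * bs_density s) \<partial>std_normal_distribution) < c"
  shows "eventually (\<lambda>n. (\<integral>s. V (y' * exp (- a n * s - b n)) \<partial>\<mu> n) < c) sequentially"
proof -
  interpret N: utility_density U std_normal_distribution bs_density by (rule std_normal_utility_density)
  have y': "0 < y'" using y by simp
  define \<epsilon> where "\<epsilon> = (c - N.expectation (\<lambda>s. V (y * bs_density s))) / 2"
  have \<epsilon>: "0 < \<epsilon>" using c by (simp add: \<epsilon>_def)
  \<comment> \<open>With this \<open>l\<close>, evaluating at \<open>bs_density / l\<close> turns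
    \<open>y'\<close> back into \<open>y\<close>, for which integrability is assumed.\<close>
  define l where "l = y' / y"
  have l: "1 < l" using y by (simp add: l_def)
  have "\<exists>C\<ge>1. eventually (\<lambda>n. \<forall>z>0. measure (\<mu> n) {s. exp (- a n * s - b n) \<le> z}
    \<le> C * measure std_normal_distribution {s. bs_density s < l * z}) sequentially"
    by (rule density_tail_dominated[OF \<mu>(1) a b _ l]) (rule chernoff)
  then obtain C where C: "1 \<le> C" and tail: "eventually (\<lambda>n. \<forall>z>0. measure (\<mu> n) {s. exp (- a n * s - b n) \<le> z}
    \<le> C * measure std_normal_distribution {s. bs_density s < l * z}) sequentially"
    by (elim exE conjE)
  define g where "g k z = max 0 (V (y' * z) - V (y' * k))" for k z
  have V_comp: "continuous_on {0<..} (\<lambda>z. V (y' * z))"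
    by (rule continuous_on_compose2[OF V_continuous]) (use y' in \<open>auto intro!: continuous_intros\<close>)
  have V_comp_max: "continuous_on {0<..} (\<lambda>z. V (y' * max z k))" if "0 < k" for k
    by (rule continuous_on_compose2[OF V_continuous])
      (use y' that in \<open>auto intro!: continuous_intros simp: less_max_iff_disj\<close>)
  have g_cont: "continuous_on {0<..} (g k)" for k
    unfolding g_def by (intro continuous_intros V_comp)
  have g_anti: "g k w \<le> g k z" if "0 < z" "z \<le> w" for k z w
    unfolding g_def using V_antimono[of "y' * z" "y' * w"] that y' by auto
  have [measurable]: "(\<lambda>s. V (y * bs_density s)) \<in> borel_measurable borel"
    using borel_measurable_integrable[OF V_int] by simp
  have g_meas: "(\<lambda>s. g k (bs_density s / l)) \<in> borel_measurable borel" for k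
    using N.Z_measurable l by (intro measurable_comp_pos[OF g_cont]) (auto simp: bs_density_def)
  have g_scaled: "g k (bs_density s / l) = max 0 (V (y * bs_density s) - V (y' * k))" for k s
    using y by (simp add: g_def l_def mult.commute)
  have g_scaled_le: "g k (bs_density s / l) \<le> \<bar>V (y * bs_density s)\<bar> + \<bar>V y'\<bar>" if "0 < k" "k \<le> 1" for k s
  proof -
    have "V y' \<le> V (y' * k)" using that y' by (intro V_antimono) auto
    then show ?thesis unfolding g_scaled by auto
  qed
  \<comment> \<open>Pointwise the excess vanishes once \<open>y' * k\<close> is below
    \<open>y * bs_density s\<close>. Since \<open>C\<close> depends only on \<open>l\<close>,
    \<open>k\<close> can afterwards be taken so small that \<open>C\<close> times the excess is
    below \<open>\<epsilon>\<close>.\<close>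
  have "(\<lambda>m. N.expectation (\<lambda>s. g (1 / real (Suc m)) (bs_density s / l))) \<longlonglongrightarrow> N.expectation (\<lambda>s. 0)"
  proof (rule integral_dominated_convergence)
    show "integrable std_normal_distribution (\<lambda>s. \<bar>V (y * bs_density s)\<bar> + \<bar>V y'\<bar>)"
      using V_int by auto
    show "AE s in std_normal_distribution. (\<lambda>m. g (1 / real (Suc m)) (bs_density s / l)) \<longlonglongrightarrow> 0"
    proof (rule AE_I2)
      fix s
      have "(\<lambda>m. y' * (1 / real (Suc m))) \<longlonglongrightarrow> y' * 0"
        by (intro tendsto_mult_left LIMSEQ_Suc[OF lim_const_over_n])
      then have "eventually (\<lambda>m. y' * (1 / real (Suc m)) < y * bs_density s) sequentially"
        by (rule order_tendstoD(2)) (use y in \<open>simp add: bs_density_def\<close>)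
      then have "eventually (\<lambda>m. 0 = g (1 / real (Suc m)) (bs_density s / l)) sequentially"
      proof eventually_elim
        case (elim m)
        have "V (y * bs_density s) \<le> V (y' * (1 / real (Suc m)))"
          using elim y' by (intro V_antimono) auto
        then show ?case unfolding g_scaled by simp
      qed
      then show "(\<lambda>m. g (1 / real (Suc m)) (bs_density s / l)) \<longlonglongrightarrow> 0"
        by (rule Lim_transform_eventually[OF tendsto_const])
    qed
    show "AE s in std_normal_distribution. norm (g (1 / real (Suc m)) (bs_density s / l)) \<le> \<bar>V (y * bs_density s)\<bar> + \<bar>V y'\<bar>" for m
      using g_scaled_le[of "1 / real (Suc m)"] by (intro AE_I2) (auto simp: g_def)
  qed (use g_meas in auto)
  then have "eventually (\<lambda>m. N.expectation (\<lambda>s. g (1 / real (Suc m)) (bs_density s / l)) < \<epsilon> / C) sequentially"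
    by (rule order_tendstoD(2)) (use \<epsilon> C in simp)
  then obtain m where m: "N.expectation (\<lambda>s. g (1 / real (Suc m)) (bs_density s / l)) < \<epsilon> / C"
    by (auto dest!: eventually_happens)
  define k where "k = 1 / real (Suc m)"
  have k: "0 < k" "k \<le> 1" by (auto simp: k_def)
  have m: "C * N.expectation (\<lambda>s. g k (bs_density s / l)) < \<epsilon>"
    using m C by (simp add: k_def field_simps)
  have g_scaled_int: "integrable std_normal_distribution (\<lambda>s. g k (bs_density s / l))"
  proof (rule Bochner_Integration.integrable_bound)
    show "integrable std_normal_distribution (\<lambda>s. \<bar>V (y * bs_density s)\<bar> + \<bar>V y'\<bar>)" using V_int by auto
    show "AE s in std_normal_distribution. norm (g k (bs_density s / l)) \<le> norm (\<bar>V (y * bs_density s)\<bar> + \<bar>V y'\<bar>)"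
      using g_scaled_le[OF k] by (intro AE_I2) (auto simp: g_def)
  qed (use g_meas in auto)
  have meas_n: "(\<lambda>s. exp (- a n * s - b n)) \<in> borel_measurable borel" for n by measurable
  have comp_n: "(\<lambda>s. f (exp (- a n * s - b n))) \<in> borel_measurable borel" if "continuous_on {0<..} f" for f :: "real \<Rightarrow> real" and n
    by (rule measurable_comp_pos[OF that]) auto
  have tail_le: "eventually (\<lambda>n. (\<integral>s. g k (exp (- a n * s - b n)) \<partial>\<mu> n) < \<epsilon>) sequentially"
    using tail
  proof eventually_elim
    case (elim n)
    interpret \<mu>: real_distribution "\<mu> n" by (rule \<mu>)
    have "ennreal (\<integral>s. g k (exp (- a n * s - b n)) \<partial>\<mu> n) = (\<integral>\<^sup>+ s. ennreal (g k (exp (- a n * s - b n))) \<partial>\<mu> n)"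
    proof (rule nn_integral_eq_integral[symmetric])
      show "integrable (\<mu> n) (\<lambda>s. g k (exp (- a n * s - b n)))"
        by (rule int[OF comp_n[OF g_cont]])
    qed (simp add: g_def)
    also have "\<dots> \<le> ennreal C * (\<integral>\<^sup>+ s. ennreal (g k (bs_density s / l)) \<partial>std_normal_distribution)"
    proof (rule nn_integral_antimono_le[OF \<mu>.prob_space_axioms N.prob_space_axioms C, where g="g k"
          and ?Z1.0="\<lambda>s. exp (- a n * s - b n)" and ?Z2.0="\<lambda>s. bs_density s / l"])
      show "measure (\<mu> n) {s \<in> space (\<mu> n). exp (- a n * s - b n) \<le> z} \<le>
          C * N.prob {s \<in> space std_normal_distribution. bs_density s / l < z}" if "0 < z" for z
      proof -
        have 1: "{s \<in> space (\<mu> n). exp (- a n * s - b n) \<le> z} = {s. exp (- a n * s - b n) \<le> z}" by simp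
        have 2: "{s \<in> space std_normal_distribution. bs_density s / l < z} = {s. bs_density s < l * z}"
          using l by (simp add: pos_divide_less_eq mult.commute)
        show ?thesis unfolding 1 2 using elim that by blast
      qed
    qed (use l g_cont g_anti N.Z_measurable in \<open>auto simp: bs_density_def\<close>)
    also have "\<dots> = ennreal (C * N.expectation (\<lambda>s. g k (bs_density s / l)))"
      using g_scaled_int C by (subst nn_integral_eq_integral) (auto simp: g_def ennreal_mult')
    finally have "(\<integral>s. g k (exp (- a n * s - b n)) \<partial>\<mu> n) \<le> C * N.expectation (\<lambda>s. g k (bs_density s / l))"
      using C by (subst (asm) ennreal_le_iff) (auto simp: g_def intro!: mult_nonneg_nonneg integral_nonneg_AE)
    then show ?case using m by simp
  qed
  have Vk_int: "integrable std_normal_distribution (\<lambda>s. V (y' * max (bs_density s) k))"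
    using N.integrable_V_max[of "y' * k" y'] y' k by (simp add: max_mult_distrib_left)
  have Vk_le: "N.expectation (\<lambda>s. V (y' * max (bs_density s) k)) \<le> N.expectation (\<lambda>s. V (y * bs_density s))"
  proof (rule integral_mono[OF Vk_int V_int])
    fix s
    have "0 < bs_density s" by (simp add: bs_density_def)
    then have "y * bs_density s \<le> y' * max (bs_density s) k"
      using y by (intro mult_mono) auto
    then show "V (y' * max (bs_density s) k) \<le> V (y * bs_density s)"
      using \<open>0 < bs_density s\<close> y by (intro V_antimono) auto
  qed
  have "eventually (\<lambda>n. - (N.expectation (\<lambda>s. V (y * bs_density s)) + \<epsilon>) <
      (\<integral>s. - V (y' * max (exp (- a n * s - b n)) k) \<partial>\<mu> n)) sequentially"
  proof (rule expectation_liminf[OF \<mu> a(1) b _ D_mean, where K="V (y' * k)" and L=0 and g="\<lambda>z. - V (y' * max z k)"])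
    show "- (V (y' * k) + 0 * z) \<le> - V (y' * max z k)" if "0 < z" for z
      using V_antimono[of "y' * k" "y' * max z k"] y' k by simp
    show "- (N.expectation (\<lambda>s. V (y * bs_density s)) + \<epsilon>) < N.expectation (\<lambda>s. - V (y' * max (bs_density s) k))"
      using Vk_le \<epsilon> Vk_int by simp
    show "continuous_on {0<..} (\<lambda>z. - V (y' * max z k))" by (intro continuous_on_minus V_comp_max k)
    then show "integrable (\<mu> n) (\<lambda>s. - V (y' * max (exp (- a n * s - b n)) k))" for n
      by (rule int[OF comp_n])
    show "integrable (\<mu> n) (\<lambda>s. exp (- a n * s - b n))" for n by (rule int[OF meas_n])
    show "integrable std_normal_distribution (\<lambda>s. - V (y' * max (bs_density s) k))" using Vk_int by simp
  qed
  with tail_le show ?thesis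
  proof eventually_elim
    case (elim n)
    have i1: "integrable (\<mu> n) (\<lambda>s. V (y' * max (exp (- a n * s - b n)) k))"
      by (intro int comp_n[of "\<lambda>z. V (y' * max z k)"] V_comp_max k)
    have i2: "integrable (\<mu> n) (\<lambda>s. g k (exp (- a n * s - b n)))"
      by (intro int comp_n g_cont)
    \<comment> \<open>For \<open>z \<ge> k\<close> the excess is 0 by monotonicity of
      \<open>V\<close>; for \<open>z < k\<close> the truncated term is
      \<open>V (y' * k)\<close>.\<close>
    have "V (y' * z) = V (y' * max z k) + g k z" if "0 < z" for z
      using V_antimono[of "y' * z" "y' * k"] V_antimono[of "y' * k" "y' * z"] y' k that
      by (auto simp: g_def max_def)
    then have "(\<integral>s. V (y' * exp (- a n * s - b n)) \<partial>\<mu> n) =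
        (\<integral>s. V (y' * max (exp (- a n * s - b n)) k) + g k (exp (- a n * s - b n)) \<partial>\<mu> n)"
      by simp
    also have "\<dots> = (\<integral>s. V (y' * max (exp (- a n * s - b n)) k) \<partial>\<mu> n) + (\<integral>s. g k (exp (- a n * s - b n)) \<partial>\<mu> n)"
      using i1 i2 by (rule Bochner_Integration.integral_add)
    also have "\<dots> < (N.expectation (\<lambda>s. V (y * bs_density s)) + \<epsilon>) + \<epsilon>"
      using elim by simp
    also have "\<dots> = c" by (simp add: \<epsilon>_def field_simps)
    finally show ?case .
  qed
qed

end

section \<open>The binomial values approach the dual value from both sides\<close>

locale binomial_utility = utility U + binomial_model p for U :: "real \<Rightarrow> real" and p :: real
begin

lemma binomial_density:
  assumes n: "0 < n"
  shows "utility_density U (measure_pmf (binom_P p n)) (dens n)"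
proof -
  have "measure_pmf.expectation (binom_P p n) (dens n) = 1"
    using expectation_Pstar[OF n, of "\<lambda>_. 1"] by simp
  then show ?thesis
    using dens_pos[OF n] integrable_P
    by (intro utility_density.intro utility_axioms measure_pmf.prob_space_axioms utility_density_axioms.intro) auto
qed

lemma law_mean: "0 < n \<Longrightarrow> (\<integral>s. exp (- an n * s - bn n) \<partial>law n) = 1"
proof -
  assume n: "0 < n"
  interpret utility_density U "measure_pmf (binom_P p n)" "dens n" by (rule binomial_density[OF n])
  have "dens n = (\<lambda>\<omega>. exp (- an n * binom_xi p n n \<omega> - bn n))" by (rule ext) (rule dens_eq[OF n])
  then show ?thesis using Z_mean by (simp add: integral_law)
qed

text \<open>The facts on \<open>an\<close>, \<open>bn\<close> and the density assume
  \<open>0 < n\<close>, so the limit lemmas are applied to sequences shifted by one.\<close>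

lemma weak_conv_law_Suc: "weak_conv_m (\<lambda>n. law (Suc n)) std_normal_distribution"
  using weak_conv_law unfolding weak_conv_m_def weak_conv_def by (auto intro: LIMSEQ_Suc)

lemma dens_cong: "(\<And>j. j < n \<Longrightarrow> \<omega> j = \<omega>' j) \<Longrightarrow> dens n \<omega> = dens n \<omega>'"
  by (simp add: dens_def)

lemma binom_value_eventually_less:
  assumes x: "0 < x" and c: "dual_bound x < ereal c"
  shows "eventually (\<lambda>n. binom_value p n U x < ereal c) sequentially"
proof -
  obtain y where y: "0 < y" and V_int: "integrable std_normal_distribution (\<lambda>s. V (y * bs_density s))"
    and less: "(\<integral>s. V (y * bs_density s) \<partial>std_normal_distribution) + x * y < c"
    using dual_bound_less[OF c] by blast
  \<comment> \<open>Half of the gap pays for raising \<open>y\<close> to \<open>y'\<close>; a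
    quarter is reserved so that the supremum, which preserves only \<open>\<le>\<close>, still stays
    strictly below \<open>c\<close>.\<close>
  define gap where "gap = c - ((\<integral>s. V (y * bs_density s) \<partial>std_normal_distribution) + x * y)"
  define y' where "y' = y + gap / (2 * x)"
  have gap: "0 < gap" using less by (simp add: gap_def)
  then have y': "y < y'" "0 < y'" using x y by (auto simp: y'_def add_pos_pos)
  have "x * y' = x * y + gap / 2" using x by (simp add: y'_def field_simps)
  then have less': "(\<integral>s. V (y * bs_density s) \<partial>std_normal_distribution) < c - gap / 4 - x * y'"
    using gap by (simp add: gap_def field_simps)
  have "eventually (\<lambda>n. (\<integral>s. V (y' * exp (- an (Suc n) * s - bn (Suc n))) \<partial>law (Suc n)) < c - gap / 4 - x * y') sequentially"
    by (rule expectation_V_limsup[OF real_distribution_law weak_conv_law_Suc LIMSEQ_Suc[OF an_limit]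
          an_le[OF zero_less_Suc] LIMSEQ_Suc[OF bn_limit] chernoff[OF zero_less_Suc] law_mean[OF zero_less_Suc]
          integrable_law y y'(1) V_int less'])
  then have "eventually (\<lambda>n. binom_value p (Suc n) U x < ereal c) sequentially"
  proof eventually_elim
    case (elim n)
    let ?n = "Suc n"
    interpret P: utility_density U "measure_pmf (binom_P p ?n)" "dens ?n" by (rule binomial_density) simp
    have meas: "(\<lambda>s. V (y' * exp (- an ?n * s - bn ?n))) \<in> borel_measurable borel"
      using y' by (intro measurable_comp_pos[OF V_continuous]) auto
    have "measure_pmf.expectation (binom_P p ?n) (\<lambda>\<omega>. V (y' * dens ?n \<omega>)) < c - gap / 4 - x * y'"
      using elim by (simp only: integral_law[OF meas] dens_eq[OF zero_less_Suc])
    then have le: "measure_pmf.expectation (binom_P p ?n) (\<lambda>\<omega>. V (y' * dens ?n \<omega>)) + x * y' \<le> c - gap / 4" by simp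
    have "binom_value p ?n U x \<le> ereal (c - gap / 4)"
      unfolding binom_value_def
    proof (rule SUP_least)
      fix X assume X: "X \<in> {X. (\<forall>\<omega> \<omega>'. (\<forall>j<?n. \<omega> j = \<omega>' j) \<longrightarrow> X \<omega> = X \<omega>') \<and> (\<forall>\<omega>. 0 \<le> X \<omega>) \<and>
              measure_pmf.expectation (binom_Pstar p ?n) X \<le> x}"
      then have "exp_utility (measure_pmf (binom_P p ?n)) U X \<le> ereal (measure_pmf.expectation (binom_P p ?n) (\<lambda>\<omega>. V (y' * dens ?n \<omega>)) + x * y')"
        by (intro P.weak_duality y' integrable_P) (auto simp: expectation_Pstar)
      also have "\<dots> \<le> ereal (c - gap / 4)" using le by simp
      finally show "exp_utility (measure_pmf (binom_P p ?n)) U X \<le> ereal (c - gap / 4)" .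
    qed
    also have "\<dots> < ereal c" using gap by simp
    finally show ?case .
  qed
  then show ?thesis by (rule eventually_sequentially_Suc[THEN iffD1])
qed

text \<open>The same function of the density is used as payoff in all models. Its utility and, with
  reversed sign, its cost are both lower semicontinuous along the sequence, so both strict
  inequalities persist for large \<open>n\<close>.\<close>

lemma binom_value_eventually_greater:
  assumes x: "0 < x" and c: "ereal c < dual_bound x"
  shows "eventually (\<lambda>n. ereal c < binom_value p n U x) sequentially"
proof -
  interpret N: utility_density U std_normal_distribution bs_density by (rule std_normal_utility_density)
  obtain d y where d: "0 < d" and y: "0 < y"
    and budget: "(\<integral>s. bs_density s * I (max (y * bs_density s) d) \<partial>std_normal_distribution) < x"
    and util: "c < (\<integral>s. U (I (max (y * bs_density s) d)) \<partial>std_normal_distribution)"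
    using near_optimal[OF x c] by blast
  have cont: "continuous_on {0<..} (\<lambda>z. f (max (y * z) d))" if "continuous_on {0<..} f" for f :: "real \<Rightarrow> real"
    by (rule continuous_on_compose2[OF that]) (use y d in \<open>auto intro!: continuous_intros simp: less_max_iff_disj\<close>)
  have contI: "continuous_on {0<..} (\<lambda>z. - (z * I (max (y * z) d)))"
    by (intro continuous_intros cont I_continuous)
  have law_int: "integrable (law n) (\<lambda>s. f (exp (- an n * s - bn n)))" if "continuous_on {0<..} f" for f :: "real \<Rightarrow> real" and n
    by (intro integrable_law measurable_comp_pos[OF that]) auto
  have "eventually (\<lambda>n. c < (\<integral>s. U (I (max (y * exp (- an (Suc n) * s - bn (Suc n))) d)) \<partial>law (Suc n))) sequentially"
  proof (rule expectation_liminf[OF real_distribution_law weak_conv_law_Suc LIMSEQ_Suc[OF an_limit] LIMSEQ_Suc[OF bn_limit]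
        _ law_mean[OF zero_less_Suc], where K="d - U 1" and L=y and g="\<lambda>z. U (I (max (y * z) d))"])
    \<comment> \<open>The constants come from Fenchel at \<open>a = 1\<close>:
      \<open>U 1 \<le> V t + t\<close> with
      \<open>t = max (y * z) d \<le> y * z + d\<close>.\<close>
    fix z :: real assume z: "0 < z"
    let ?t = "max (y * z) d"
    have "U 1 \<le> V ?t + ?t" using d fenchel[of ?t 1] by (simp add: less_max_iff_disj)
    moreover have "?t \<le> y * z + d" using y z d by auto
    moreover have "0 \<le> ?t * I ?t" using d I_pos[of ?t] by (intro mult_nonneg_nonneg) (auto simp: less_max_iff_disj)
    ultimately show "- (d - U 1 + y * z) \<le> U (I ?t)" unfolding V_def by linarith
  next
    show "integrable std_normal_distribution (\<lambda>s. U (I (max (y * bs_density s) d)))"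
      using N.integrable_U_J[OF d, of y] y by (simp add: N.J_def)
    show "continuous_on {0<..} (\<lambda>z. U (I (max (y * z) d)))" by (rule cont[OF U_I_continuous])
    show "integrable (law (Suc n)) (\<lambda>s. exp (- an (Suc n) * s - bn (Suc n)))" for n
      by (rule integrable_law) measurable
    show "integrable (law (Suc n)) (\<lambda>s. U (I (max (y * exp (- an (Suc n) * s - bn (Suc n))) d)))" for n
      by (rule law_int[OF cont[OF U_I_continuous]])
  qed (rule util)
  moreover have "eventually (\<lambda>n. - x < (\<integral>s. - (exp (- an (Suc n) * s - bn (Suc n)) *
      I (max (y * exp (- an (Suc n) * s - bn (Suc n))) d)) \<partial>law (Suc n))) sequentially"
  proof (rule expectation_liminf[OF real_distribution_law weak_conv_law_Suc LIMSEQ_Suc[OF an_limit] LIMSEQ_Suc[OF bn_limit]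
        _ law_mean[OF zero_less_Suc], where K=0 and L="I d" and g="\<lambda>z. - (z * I (max (y * z) d))"])
    fix z :: real assume z: "0 < z"
    have "I (max (y * z) d) \<le> I d" using d by (intro I_antimono) auto
    then show "- (0 + I d * z) \<le> - (z * I (max (y * z) d))" using z by (simp add: mult.commute)
  next
    show "integrable std_normal_distribution (\<lambda>s. - (bs_density s * I (max (y * bs_density s) d)))"
      using N.integrable_Z_J[OF d, of y] by (simp add: N.J_def)
    show "- x < N.expectation (\<lambda>s. - (bs_density s * I (max (y * bs_density s) d)))" using budget by simp
    show "integrable (law (Suc n)) (\<lambda>s. exp (- an (Suc n) * s - bn (Suc n)))" for n
      by (rule integrable_law) measurable
    show "integrable (law (Suc n)) (\<lambda>s. - (exp (- an (Suc n) * s - bn (Suc n)) *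
      I (max (y * exp (- an (Suc n) * s - bn (Suc n))) d)))" for n
      by (rule law_int[OF contI])
  qed (rule contI)
  ultimately have "eventually (\<lambda>n. ereal c < binom_value p (Suc n) U x) sequentially"
  proof eventually_elim
    case (elim n)
    let ?n = "Suc n"
    interpret P: utility_density U "measure_pmf (binom_P p ?n)" "dens ?n" by (rule binomial_density) simp
    have meas: "(\<lambda>s. f (exp (- an ?n * s - bn ?n))) \<in> borel_measurable borel" if "continuous_on {0<..} f" for f :: "real \<Rightarrow> real"
      by (rule measurable_comp_pos[OF that]) auto
    have util_n: "c < measure_pmf.expectation (binom_P p ?n) (\<lambda>\<omega>. U (P.J d y \<omega>))"
      using elim(1) by (simp only: integral_law[OF meas[OF cont[OF U_I_continuous]]] dens_eq[OF zero_less_Suc] P.J_def)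
    have "- x < measure_pmf.expectation (binom_P p ?n) (\<lambda>\<omega>. - (dens ?n \<omega> * P.J d y \<omega>))"
      using elim(2) by (simp only: integral_law[OF meas[OF contI]] dens_eq[OF zero_less_Suc] P.J_def)
    then have budget_n: "measure_pmf.expectation (binom_P p ?n) (\<lambda>\<omega>. dens ?n \<omega> * P.J d y \<omega>) \<le> x" by simp
    have "ereal c < ereal (measure_pmf.expectation (binom_P p ?n) (\<lambda>\<omega>. U (P.J d y \<omega>)))" using util_n by simp
    also have "\<dots> = exp_utility (measure_pmf (binom_P p ?n)) U (P.J d y)"
      using P.J_pos[OF d] by (intro P.exp_utility_eq_expectation[symmetric] integrable_P) auto
    also have "\<dots> \<le> binom_value p ?n U x"
      unfolding binom_value_def
    proof (rule SUP_upper, safe)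
      show "P.J d y \<omega> = P.J d y \<omega>'" if "\<forall>j<?n. \<omega> j = \<omega>' j" for \<omega> \<omega>'
        using dens_cong[of ?n \<omega> \<omega>'] that by (simp add: P.J_def)
      show "0 \<le> P.J d y \<omega>" for \<omega> using P.J_pos[OF d] by (simp add: less_imp_le)
      show "measure_pmf.expectation (binom_Pstar p ?n) (P.J d y) \<le> x"
        using budget_n by (simp add: expectation_Pstar)
    qed
    finally show ?case .
  qed
  then show ?thesis by (rule eventually_sequentially_Suc[THEN iffD1])
qed

lemma binom_value_tendsto: "0 < x \<Longrightarrow> (\<lambda>n. binom_value p n U x) \<longlonglongrightarrow> dual_bound x"
proof (rule order_tendstoI)
  fix c assume x: "0 < x" and "c < dual_bound x"
  then obtain r where "c < ereal r" "ereal r < dual_bound x" using ereal_dense2 by blast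
  from binom_value_eventually_greater[OF x this(2)]
  show "eventually (\<lambda>n. c < binom_value p n U x) sequentially"
    by eventually_elim (use \<open>c < ereal r\<close> in \<open>rule less_trans\<close>)
next
  fix c assume x: "0 < x" and "dual_bound x < c"
  then obtain r where "ereal r < c" "dual_bound x < ereal r" using ereal_dense2 by blast
  from binom_value_eventually_less[OF x this(2)]
  show "eventually (\<lambda>n. binom_value p n U x < c) sequentially"
    by eventually_elim (use \<open>ereal r < c\<close> in \<open>rule less_trans[rotated]\<close>)
qed

end

section \<open>The Black-Scholes-Merton value\<close>

context utility
begin

text \<open>The density is a function of \<open>w 1\<close>, which is standard normal, so dual
  integrals over \<open>M\<close> become those of \<open>dual_bound\<close> and weak duality gives
  one half. For the other, the near-optimal payoffs are functions of \<open>w 1\<close>, hence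
  admissible.\<close>

lemma BSM_value_eq_dual_bound:
  assumes bm: "std_brownian_motion_01 M w" and x: "0 < x"
  shows "BSM_value M w U x = dual_bound x"
proof -
  interpret M: prob_space M using bm by (simp add: std_brownian_motion_01_def)
  interpret N: utility_density U std_normal_distribution bs_density by (rule std_normal_utility_density)
  have w_meas: "w t \<in> borel_measurable M" if "t \<in> {0..1}" for t
    using bm that by (simp add: std_brownian_motion_01_def)
  have w1 [measurable]: "w 1 \<in> borel_measurable M" by (rule w_meas) simp
  have w0: "w 0 \<omega> = 0" if "\<omega> \<in> space M" for \<omega> using bm that by (simp add: std_brownian_motion_01_def)
  have "distributed M lborel (\<lambda>\<omega>. w 1 \<omega> - w 0 \<omega>) (\<lambda>x. ennreal (normal_density 0 (sqrt (1 - 0)) x))"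
    using bm unfolding std_brownian_motion_01_def by (elim conjE allE[where x=0] allE[where x=1]) auto
  then have "distr M lborel (\<lambda>\<omega>. w 1 \<omega> - w 0 \<omega>) = std_normal_distribution"
    by (simp add: distributed_def)
  also have "distr M lborel (\<lambda>\<omega>. w 1 \<omega> - w 0 \<omega>) = distr M borel (w 1)"
    by (rule distr_cong) (auto simp: w0)
  finally have distr_w1: "distr M borel (w 1) = std_normal_distribution" .
  have integral_w1: "M.expectation (\<lambda>\<omega>. f (w 1 \<omega>)) = N.expectation f"
    and integrable_w1: "integrable M (\<lambda>\<omega>. f (w 1 \<omega>)) \<longleftrightarrow> integrable std_normal_distribution f"
    if "f \<in> borel_measurable borel" for f :: "real \<Rightarrow> real"
    using that by (simp_all add: distr_w1[symmetric] integral_distr integrable_distr_eq)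
  have dens_w: "BSM_density w \<omega> = bs_density (w 1 \<omega>)" for \<omega> by (simp add: BSM_density_def bs_density_def)
  have bs_meas [measurable]: "bs_density \<in> borel_measurable borel" unfolding bs_density_def by measurable
  interpret D: utility_density U M "BSM_density w"
  proof
    show "0 < BSM_density w \<omega>" for \<omega> by (simp add: BSM_density_def)
    show "integrable M (BSM_density w)" "M.expectation (BSM_density w) = 1"
      using integrable_w1[OF bs_meas] integral_w1[OF bs_meas] integrable_bs_density integral_bs_density
      by (simp_all add: dens_w[abs_def])
  qed
  have V_meas: "(\<lambda>s. V (y * bs_density s)) \<in> borel_measurable borel" if "0 < y" for y
    using that by (intro measurable_comp_pos[OF V_continuous]) (auto simp: bs_density_def)
  have sub: "X \<in> borel_measurable M" if X: "X \<in> borel_measurable (BM_sigma M w)" for X :: "_ \<Rightarrow> real"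
  proof (rule measurable_from_subalg[OF _ X])
    show "subalgebra M (BM_sigma M w)"
      unfolding subalgebra_def
    proof
      show "space (BM_sigma M w) = space M" by (auto simp: BM_sigma_def space_measure_of_conv)
      have "(\<Union>t\<in>{0..1}. {w t -` A \<inter> space M | A. A \<in> sets borel}) \<subseteq> sets M"
        using w_meas by (auto dest: measurable_sets)
      then show "sets (BM_sigma M w) \<subseteq> sets M"
        unfolding BM_sigma_def using sets.sets_into_space
        by (subst sets_measure_of) (auto intro!: sets.sigma_sets_subset)
    qed
  qed
  show ?thesis
  proof (rule antisym)
    show "BSM_value M w U x \<le> dual_bound x"
      unfolding BSM_value_def
    proof (rule SUP_least)
      fix X assume "X \<in> {X. X \<in> borel_measurable (BM_sigma M w) \<and> (\<forall>\<omega>\<in>space M. 0 \<le> X \<omega>) \<and>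
              (\<integral>\<^sup>+ \<omega>. ennreal (BSM_density w \<omega> * X \<omega>) \<partial>M) \<le> ennreal x}"
      then have X_sub: "X \<in> borel_measurable (BM_sigma M w)" and X0: "\<And>\<omega>. \<omega> \<in> space M \<Longrightarrow> 0 \<le> X \<omega>"
        and budget: "(\<integral>\<^sup>+ \<omega>. ennreal (BSM_density w \<omega> * X \<omega>) \<partial>M) \<le> ennreal x"
        by simp_all
      have X [measurable]: "X \<in> borel_measurable M" by (rule sub[OF X_sub])
      have ZX0: "AE \<omega> in M. 0 \<le> BSM_density w \<omega> * X \<omega>"
        using X0 D.Z_pos by (intro AE_I2 mult_nonneg_nonneg) (auto simp: less_imp_le)
      have "(\<integral>\<^sup>+ \<omega>. ennreal (BSM_density w \<omega> * X \<omega>) \<partial>M) < \<infinity>"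
        using budget by (rule le_less_trans) simp
      then have ZX: "integrable M (\<lambda>\<omega>. BSM_density w \<omega> * X \<omega>)"
        using ZX0 by (intro integrableI_nonneg) auto
      have "ennreal (M.expectation (\<lambda>\<omega>. BSM_density w \<omega> * X \<omega>)) \<le> ennreal x"
        using budget nn_integral_eq_integral[OF ZX ZX0] by simp
      then have le: "M.expectation (\<lambda>\<omega>. BSM_density w \<omega> * X \<omega>) \<le> x"
        using x by (simp add: ennreal_le_iff)
      show "exp_utility M U X \<le> dual_bound x"
        unfolding dual_bound_def
      proof (rule INF_greatest, safe)
        fix y :: real assume y: "0 < y" and V_int: "integrable std_normal_distribution (\<lambda>s. V (y * bs_density s))"
        have "integrable M (\<lambda>\<omega>. V (y * BSM_density w \<omega>))"
          unfolding dens_w using integrable_w1[OF V_meas[OF y]] V_int by simp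
        from D.weak_duality[OF y this X X0 ZX le]
        show "exp_utility M U X \<le> ereal (N.expectation (\<lambda>s. V (y * bs_density s)) + x * y)"
          unfolding dens_w integral_w1[OF V_meas[OF y]] .
      qed
    qed
  next
    show "dual_bound x \<le> BSM_value M w U x"
    proof (rule ccontr)
      assume "\<not> dual_bound x \<le> BSM_value M w U x"
      then obtain c where c: "BSM_value M w U x < ereal c" "ereal c < dual_bound x"
        using ereal_dense2[of "BSM_value M w U x" "dual_bound x"] by (auto simp: not_le)
      obtain d y where d: "0 < d" and y: "0 < y"
        and budget: "N.expectation (\<lambda>s. bs_density s * I (max (y * bs_density s) d)) < x"
        and util: "c < N.expectation (\<lambda>s. U (I (max (y * bs_density s) d)))"
        using near_optimal[OF x c(2)] by blast
      have comp: "(\<lambda>s. f (max (y * bs_density s) d)) \<in> borel_measurable borel" if "continuous_on {0<..} f" for f :: "real \<Rightarrow> real"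
        using d by (intro measurable_comp_pos[OF that]) (auto simp: less_max_iff_disj)
      have J_eq: "D.J d y \<omega> = I (max (y * bs_density (w 1 \<omega>)) d)" for \<omega> by (simp add: D.J_def dens_w)
      have "ereal c < ereal (M.expectation (\<lambda>\<omega>. U (D.J d y \<omega>)))"
        unfolding J_eq using util integral_w1[OF comp[OF U_I_continuous]] by simp
      also have "\<dots> = exp_utility M U (D.J d y)"
        using D.J_pos[OF d] D.integrable_U_J[OF d] y by (intro D.exp_utility_eq_expectation[symmetric]) auto
      also have "\<dots> \<le> BSM_value M w U x"
        unfolding BSM_value_def
      proof (rule SUP_upper, safe)
        have "w 1 \<in> borel_measurable (BM_sigma M w)"
        proof (rule measurableI)
          fix A :: "real set" assume "A \<in> sets borel"
          then have "w 1 -` A \<inter> space M \<in> (\<Union>t\<in>{0..1}. {w t -` A \<inter> space M | A. A \<in> sets borel})"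
            by (intro UN_I[of 1]) auto
          then show "w 1 -` A \<inter> space (BM_sigma M w) \<in> sets (BM_sigma M w)"
            by (auto simp: BM_sigma_def space_measure_of_conv)
        qed simp
        from measurable_compose[OF this comp[OF I_continuous]]
        show "D.J d y \<in> borel_measurable (BM_sigma M w)"
          by (simp add: J_eq[abs_def])
        show "0 \<le> D.J d y \<omega>" for \<omega> using D.J_pos[OF d] by (simp add: less_imp_le)
        have meas: "(\<lambda>s. bs_density s * I (max (y * bs_density s) d)) \<in> borel_measurable borel"
          using comp[OF I_continuous] by measurable
        have "(\<integral>\<^sup>+ \<omega>. ennreal (BSM_density w \<omega> * D.J d y \<omega>) \<partial>M) = ennreal (M.expectation (\<lambda>\<omega>. BSM_density w \<omega> * D.J d y \<omega>))"
          using D.integrable_Z_J[OF d] D.J_pos[OF d] D.Z_pos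
          by (intro nn_integral_eq_integral AE_I2) (auto simp: less_imp_le)
        also have "M.expectation (\<lambda>\<omega>. BSM_density w \<omega> * D.J d y \<omega>) = N.expectation (\<lambda>s. bs_density s * I (max (y * bs_density s) d))"
          unfolding J_eq dens_w by (rule integral_w1[OF meas])
        also have "ennreal \<dots> \<le> ennreal x" using budget by (intro ennreal_leI) simp
        finally show "(\<integral>\<^sup>+ \<omega>. ennreal (BSM_density w \<omega> * D.J d y \<omega>) \<partial>M) \<le> ennreal x" .
      qed
      finally show False using c(1) by simp
    qed
  qed
qed

end

theorem theorem1p1:
  fixes U :: "real \<Rightarrow> real" and p :: real
    and M :: "'a measure" and w :: "real \<Rightarrow> 'a \<Rightarrow> real"
  assumes "utility_function U"
    and "1/2 \<le> p" and "p < 1"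
    and "std_brownian_motion_01 M w"
  shows "\<forall>x>0. (\<lambda>n. binom_value p n U x) \<longlonglongrightarrow> BSM_value M w U x"
proof (intro allI impI)
  fix x :: real assume x: "0 < x"
  interpret binomial_utility U p
    by (intro binomial_utility.intro utility.intro binomial_model.intro assms)
  show "(\<lambda>n. binom_value p n U x) \<longlonglongrightarrow> BSM_value M w U x"
    unfolding BSM_value_eq_dual_bound[OF assms(4) x] by (rule binom_value_tendsto[OF x])
qed

end
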